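(* Let $M$ be a regular orthogonal matroid on the ground set $E\cup E^*$ with set of bases $\mathcal B(M)$, and let $\mathcal C$ be a regular orthogonal representation of $M$. (1) The rule $[\mathbf v]_{\mathrm J}\cdot[\mathbf O_1]_{\mathrm R}:=[\mathbf O_2]_{\mathrm R}$, where $\mathbf O_2$ is any orientation with $\mathbf v+\mathbf O_1\sim_{\mathrm J}\mathbf O_2$, is a well-defined simply transitive action of $\mathrm{Jac}(\mathcal C)$ on $\mathcal R(\mathcal C)$. (2) For every acyclic circuit signature $\sigma$ of $\mathcal C$, the map $\bar\beta_\sigma:\mathcal B(M)\to\mathcal R(\mathcal C)$, $B\mapsto[\beta_\sigma(B)]_{\mathrm R}$, is a bijection. Consequently $\Gamma_{\beta_\sigma}([\mathbf v]_{\mathrm J},B):=\bar\beta_\sigma^{-1}([\mathbf v]_{\mathrm J}\cdot\bar\beta_\sigma(B))$ is a simply transitive action of $\mathrm{Jac}(\mathcal C)$ on $\mathcal B(M)$. (3) Both are invariant under reorientation: for every $X\subseteq E$, the map $[\mathbf v]_{\mathrm J}\mapsto[\mathbf v^X]_{\mathrm J}$ is a group isomorphism $\mathrm{Jac}(\mathcal C)\to\mathrm{Jac}(\mathcal C^X)$, and for every acyclic circuit signature $\sigma$ of $\mathcal C$, all $\mathbf v\in\mathbb Z^E$ and all $B_1,B_2\in\mathcal B(M)$, $$\Gamma_{\beta_\sigma}([\mathbf v]_{\mathrm J},B_1)=B_2\iff\Gamma_{\beta_{\sigma^X}}([\mathbf v^X]_{\mathrm J},B_1)=B_2,$$ where $\sigma^X=\{\mathbf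 C^X:\mathbf C\in\sigma\}$ is an acyclic circuit signature of $\mathcal C^X$.
   Context: Orthogonal matroids. $E$ is a finite set with $|E|=n$, $E^*=\{e^*:e\in E\}$ a disjoint copy, $(e^* )^*=e$, $X^*=\{x^*:x\in X\}$. A transversal is an $n$-element subset of $E\cup E^*$ containing no pair $\{e,e^*\}$; a subtransversal is a subset of a transversal. An orthogonal matroid on $E\cup E^*$ is a pair $M=(E\cup E^*,\mathcal B)$ with $\mathcal B$ a nonempty set of transversals (bases) such that for all $B,B'\in\mathcal B$ and $e\in B\setminus B'$ there is $f\neq e$ in $B\setminus B'$ with $B\triangle\{e,e^*,f,f^*\}\in\mathcal B$. A circuit is a minimal subtransversal not contained in any basis. For a basis $B$ and $e\in B^*$, $\mathrm{FC}(B,e)$ is the unique circuit contained in $B\triangle\{e,e^*\}$. Representations. For $\mathbf C\in\mathbb Z^{E\cup E^*}$ let $\mathbf C^*(e)=\mathbf C(e^* )$. A regular orthogonal representation of $M$ is a set $\mathcal C$ of $(0,\pm1)$-vectors in $\mathbb Z^{E\cup E^*}$ (signed circuits) with $\mathcal C=-\mathcal C$, with $\{\mathrm{supp}(\mathbf C):\mathbf C\in\mathcal C\}$ equal to the set of circuits of $M$, and with $\langle\mathbf C,\mathbf D\rangle:=\sum_{e\in E\cup E^*}\mathbf C(e)\mathbf D^*(e)=0$ for all $\mathbf C,\mathbf D\in\mathcal C$. $M$ is regular if it has such a representation. Jacobian and reversal system. Let $\pi:\mathbb Q^{E\cup E^*}\to\mathbb Q^E$, $\pi(\mathbf v)(e)=\mathbf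 v(e)+\mathbf v(e^* )$, and let $\langle\pi(\mathcal C)\rangle\le\mathbb Z^E$ be the subgroup generated by $\{\pi(\mathbf C):\mathbf C\in\mathcal C\}$. For $\mathbf v_1,\mathbf v_2\in\mathbb Q^E$ write $\mathbf v_1\sim_{\mathrm J}\mathbf v_2$ if $\mathbf v_2-\mathbf v_1\in\langle\pi(\mathcal C)\rangle$, with class $[\mathbf v]_{\mathrm J}$. $\mathrm{Jac}(\mathcal C):=\mathbb Z^E/\sim_{\mathrm J}$. An orientation is an element of $\mathcal O=\{\pm\frac12\}^E$. A circuit reversal turns an orientation $\mathbf O$ into an orientation $\mathbf O+\pi(\mathbf C)$ with $\mathbf C\in\mathcal C$. $\mathcal R(\mathcal C)$ is the set of equivalence classes $[\mathbf O]_{\mathrm R}$ of orientations, two orientations being equivalent if connected by a sequence of circuit reversals. Signatures. A circuit signature of $\mathcal C$ is a subset $\sigma\subseteq\mathcal C$ containing exactly one of $\mathbf C,-\mathbf C$ for each $\mathbf C\in\mathcal C$. It is acyclic if $\sum\lambda_i\mathbf C_i=0$ with $\lambda_i\ge0$ and $\mathbf C_i\in\sigma$ implies all $\lambda_i=0$. For a basis $B$ and $e\in E$, let $e'$ be the unique element of $\{e,e^*\}\setminus B$ and $\mathbf C\in\sigma$ the unique signed circuit with support $\mathrm{FC}(B,e')$; define $\beta_\sigma(B)(e)=\frac12$ if $\mathbf C(e')=1$ and $-\frac12$ if $\mathbf C(e')=-1$. This gives $\beta_\sigma:\mathcal B(M)\to\mathcal O$. Reorientation. For $X\subseteq E$: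 $\mathbf C^X(i)=-\mathbf C(i)$ if $i\in X\cup X^*$ and $\mathbf C^X(i)=\mathbf C(i)$ otherwise; $\mathcal C^X=\{\mathbf C^X:\mathbf C\in\mathcal C\}$, again a regular orthogonal representation of $M$. For $\mathbf v\in\mathbb Q^E$: $\mathbf v^X(i)=-\mathbf v(i)$ if $i\in X$ and $\mathbf v(i)$ otherwise. *)

theory Defs
  imports
    Complex_Main
    "HOL-Library.Function_Algebras"
    "HOL-Algebra.Group_Action"
    "HOL-Algebra.Generated_Groups"
begin

section \<open>Orthogonal matroids\<close>

text \<open>
  The set \<open>E \<union> E\<^sup>*\<close> is the disjoint sum \<open>E <+> E\<close>: the element \<open>e\<close> is \<open>Inl e\<close> and its
  copy \<open>e\<^sup>*\<close> is \<open>Inr e\<close>.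
\<close>

fun star :: "'a + 'a \<Rightarrow> 'a + 'a" where
  "star (Inl e) = Inr e"
| "star (Inr e) = Inl e"

definition transversal :: "'a set \<Rightarrow> ('a + 'a) set \<Rightarrow> bool" where
  "transversal E T \<longleftrightarrow> T \<subseteq> E <+> E \<and> card T = card E \<and> (\<forall>x\<in>T. star x \<notin> T)"

definition subtransversal :: "'a set \<Rightarrow> ('a + 'a) set \<Rightarrow> bool" where
  "subtransversal E S \<longleftrightarrow> (\<exists>T. transversal E T \<and> S \<subseteq> T)"

locale orthogonal_matroid =
  fixes E :: "'a set" and Bs :: "('a + 'a) set set"
  assumes finite_ground: "finite E"
    and bases_nonempty: "Bs \<noteq> {}"
    and bases_transversal: "B \<in> Bs \<Longrightarrow> transversal E B"
    and exchange: "\<lbrakk>B \<in> Bs; B' \<in> Bs; e \<in> B - B'\<rbrakk> \<Longrightarrow>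
      \<exists>f \<in> B - B'. f \<noteq> e \<and> sym_diff B {e, star e, f, star f} \<in> Bs"

definition circuit :: "'a set \<Rightarrow> ('a + 'a) set set \<Rightarrow> ('a + 'a) set \<Rightarrow> bool" where
  "circuit E Bs K \<longleftrightarrow>
     (subtransversal E K \<and> (\<forall>B\<in>Bs. \<not> K \<subseteq> B)) \<and>
     (\<forall>K'. K' \<subset> K \<longrightarrow> \<not> (subtransversal E K' \<and> (\<forall>B\<in>Bs. \<not> K' \<subseteq> B)))"

text \<open>Meaningful for a basis \<open>B\<close> and \<open>e \<in> B\<^sup>*\<close> only.\<close>

definition FC :: "'a set \<Rightarrow> ('a + 'a) set set \<Rightarrow> ('a + 'a) set \<Rightarrow> 'a + 'a \<Rightarrow> ('a + 'a) set" where
  "FC E Bs B e = (THE K. circuit E Bs K \<and> K \<subseteq> sym_diff B {e, star e})"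


section \<open>Regular orthogonal representations\<close>

text \<open>
  Vectors indexed by a finite set \<open>S\<close> are functions vanishing outside \<open>S\<close>; addition and
  negation of functions are pointwise. All vectors, including the integral ones, have
  rational entries, so that no coercions are needed.
\<close>

definition rat_vecs :: "'i set \<Rightarrow> ('i \<Rightarrow> rat) set" where
  "rat_vecs S = {v. \<forall>i. i \<notin> S \<longrightarrow> v i = 0}"

definition int_vecs :: "'i set \<Rightarrow> ('i \<Rightarrow> rat) set" where
  "int_vecs S = {v \<in> rat_vecs S. \<forall>i\<in>S. v i \<in> \<int>}"

definition supp :: "('i \<Rightarrow> rat) \<Rightarrow> 'i set" where
  "supp v = {i. v i \<noteq> 0}"

definition pairing :: "'a set \<Rightarrow> ('a + 'a \<Rightarrow> rat) \<Rightarrow> ('a + 'a \<Rightarrow> rat) \<Rightarrow> rat" where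
  "pairing E C D = (\<Sum>e \<in> E <+> E. C e * D (star e))"

definition regular_representation ::
  "'a set \<Rightarrow> ('a + 'a) set set \<Rightarrow> ('a + 'a \<Rightarrow> rat) set \<Rightarrow> bool" where
  "regular_representation E Bs Cs \<longleftrightarrow>
     (\<forall>C\<in>Cs. C \<in> int_vecs (E <+> E) \<and> (\<forall>i. C i \<in> {0, 1, -1})) \<and>
     uminus ` Cs = Cs \<and>
     supp ` Cs = {K. circuit E Bs K} \<and>
     (\<forall>C\<in>Cs. \<forall>D\<in>Cs. pairing E C D = 0)"

definition regular_orthogonal_matroid :: "'a set \<Rightarrow> ('a + 'a) set set \<Rightarrow> bool" where
  "regular_orthogonal_matroid E Bs \<longleftrightarrow>
     orthogonal_matroid E Bs \<and> (\<exists>Cs. regular_representation E Bs Cs)"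


section \<open>Jacobian and circuit reversal system\<close>

definition proj :: "('a + 'a \<Rightarrow> rat) \<Rightarrow> 'a \<Rightarrow> rat" where
  "proj v = (\<lambda>e. v (Inl e) + v (Inr e))"

definition int_vec_group :: "'a set \<Rightarrow> ('a \<Rightarrow> rat) monoid" where
  "int_vec_group E = \<lparr>carrier = int_vecs E, mult = (+), one = 0\<rparr>"

definition circuit_lattice :: "'a set \<Rightarrow> ('a + 'a \<Rightarrow> rat) set \<Rightarrow> ('a \<Rightarrow> rat) set" where
  "circuit_lattice E Cs = generate (int_vec_group E) (proj ` Cs)"

definition J_equiv :: "'a set \<Rightarrow> ('a + 'a \<Rightarrow> rat) set \<Rightarrow> ('a \<Rightarrow> rat) \<Rightarrow> ('a \<Rightarrow> rat) \<Rightarrow> bool" where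
  "J_equiv E Cs v w \<longleftrightarrow> w - v \<in> circuit_lattice E Cs"

definition J_class :: "'a set \<Rightarrow> ('a + 'a \<Rightarrow> rat) set \<Rightarrow> ('a \<Rightarrow> rat) \<Rightarrow> ('a \<Rightarrow> rat) set" where
  "J_class E Cs v = {w. J_equiv E Cs v w}"

definition Jac :: "'a set \<Rightarrow> ('a + 'a \<Rightarrow> rat) set \<Rightarrow> ('a \<Rightarrow> rat) set monoid" where
  "Jac E Cs = int_vec_group E Mod circuit_lattice E Cs"

definition orientations :: "'a set \<Rightarrow> ('a \<Rightarrow> rat) set" where
  "orientations E = {v \<in> rat_vecs E. \<forall>e\<in>E. v e = 1/2 \<or> v e = -1/2}"

definition circuit_reversal ::
  "'a set \<Rightarrow> ('a + 'a \<Rightarrow> rat) set \<Rightarrow> (('a \<Rightarrow> rat) \<times> ('a \<Rightarrow> rat)) set" where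
  "circuit_reversal E Cs =
     {(v, w). v \<in> orientations E \<and> w \<in> orientations E \<and> (\<exists>C\<in>Cs. w = v + proj C)}"

definition R_class :: "'a set \<Rightarrow> ('a + 'a \<Rightarrow> rat) set \<Rightarrow> ('a \<Rightarrow> rat) \<Rightarrow> ('a \<Rightarrow> rat) set" where
  "R_class E Cs v = (circuit_reversal E Cs)\<^sup>* `` {v}"

definition reversal_classes :: "'a set \<Rightarrow> ('a + 'a \<Rightarrow> rat) set \<Rightarrow> ('a \<Rightarrow> rat) set set" where
  "reversal_classes E Cs = R_class E Cs ` orientations E"

text \<open>
  The rule \<open>[v]\<^sub>J \<cdot> [O\<^sub>1]\<^sub>R = [O\<^sub>2]\<^sub>R\<close>; that the description determines a unique class is
  part of what has to be shown.
\<close>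

definition jac_action ::
  "'a set \<Rightarrow> ('a + 'a \<Rightarrow> rat) set \<Rightarrow> ('a \<Rightarrow> rat) set \<Rightarrow> ('a \<Rightarrow> rat) set \<Rightarrow> ('a \<Rightarrow> rat) set" where
  "jac_action E Cs g = (\<lambda>\<Omega> \<in> reversal_classes E Cs. THE \<Omega>'.
     \<exists>v \<in> int_vecs E. \<exists>O1 \<in> orientations E. \<exists>O2 \<in> orientations E.
       g = J_class E Cs v \<and> \<Omega> = R_class E Cs O1 \<and>
       J_equiv E Cs (v + O1) O2 \<and> \<Omega>' = R_class E Cs O2)"

definition simply_transitive_action ::
  "('g, 'm) monoid_scheme \<Rightarrow> 'x set \<Rightarrow> ('g \<Rightarrow> 'x \<Rightarrow> 'x) \<Rightarrow> bool" where
  "simply_transitive_action G X \<phi> \<longleftrightarrow>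
     X \<noteq> {} \<and> group_action G X \<phi> \<and> (\<forall>x\<in>X. \<forall>y\<in>X. \<exists>!g. g \<in> carrier G \<and> \<phi> g x = y)"


section \<open>Circuit signatures\<close>

definition circuit_signature :: "('a + 'a \<Rightarrow> rat) set \<Rightarrow> ('a + 'a \<Rightarrow> rat) set \<Rightarrow> bool" where
  "circuit_signature Cs \<sigma> \<longleftrightarrow> \<sigma> \<subseteq> Cs \<and> (\<forall>C\<in>Cs. (C \<in> \<sigma>) \<noteq> (- C \<in> \<sigma>))"

text \<open>
  A circuit signature of a representation over a finite ground set is finite, so the sum
  below is a genuine finite sum.
\<close>

definition acyclic_signature :: "('a + 'a \<Rightarrow> rat) set \<Rightarrow> bool" where
  "acyclic_signature \<sigma> \<longleftrightarrow>
     (\<forall>c :: ('a + 'a \<Rightarrow> rat) \<Rightarrow> real.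
        (\<forall>C\<in>\<sigma>. c C \<ge> 0) \<and> (\<forall>i. (\<Sum>C\<in>\<sigma>. c C * of_rat (C i)) = 0) \<longrightarrow> (\<forall>C\<in>\<sigma>. c C = 0))"

definition beta ::
  "'a set \<Rightarrow> ('a + 'a) set set \<Rightarrow> ('a + 'a \<Rightarrow> rat) set \<Rightarrow> ('a + 'a) set \<Rightarrow> 'a \<Rightarrow> rat" where
  "beta E Bs \<sigma> B = (\<lambda>e. if e \<in> E then
       (let e' = (THE x. x \<in> {Inl e, Inr e} - B);
            C = (THE C. C \<in> \<sigma> \<and> supp C = FC E Bs B e')
        in if C e' = 1 then 1/2 else if C e' = -1 then -1/2 else undefined)
     else 0)"

definition beta_bar ::
  "'a set \<Rightarrow> ('a + 'a) set set \<Rightarrow> ('a + 'a \<Rightarrow> rat) set \<Rightarrow> ('a + 'a \<Rightarrow> rat) set \<Rightarrow>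
   ('a + 'a) set \<Rightarrow> ('a \<Rightarrow> rat) set" where
  "beta_bar E Bs Cs \<sigma> B = R_class E Cs (beta E Bs \<sigma> B)"

definition Gamma ::
  "'a set \<Rightarrow> ('a + 'a) set set \<Rightarrow> ('a + 'a \<Rightarrow> rat) set \<Rightarrow> ('a + 'a \<Rightarrow> rat) set \<Rightarrow>
   ('a \<Rightarrow> rat) set \<Rightarrow> ('a + 'a) set \<Rightarrow> ('a + 'a) set" where
  "Gamma E Bs Cs \<sigma> g = (\<lambda>B \<in> Bs.
     inv_into Bs (beta_bar E Bs Cs \<sigma>) (jac_action E Cs g (beta_bar E Bs Cs \<sigma> B)))"


section \<open>Reorientation\<close>

text \<open>For \<open>X \<subseteq> E\<close>, \<open>v\<^sup>X\<close> is \<open>reorient X v\<close> and \<open>C\<^sup>X\<close> is \<open>reorient (X <+> X) C\<close>.\<close>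

definition reorient :: "'i set \<Rightarrow> ('i \<Rightarrow> rat) \<Rightarrow> 'i \<Rightarrow> rat" where
  "reorient Y v = (\<lambda>i. if i \<in> Y then - v i else v i)"

definition reorient_circuits ::
  "'a set \<Rightarrow> ('a + 'a \<Rightarrow> rat) set \<Rightarrow> ('a + 'a \<Rightarrow> rat) set" where
  "reorient_circuits X Cs = reorient (X <+> X) ` Cs"


section \<open>Basic facts about the Jacobian\<close>

lemma comm_group_int_vec_group: "comm_group (int_vec_group E)"
proof (rule comm_groupI)
  fix x assume "x \<in> carrier (int_vec_group E)"
  then show "\<exists>y\<in>carrier (int_vec_group E). y \<otimes>\<^bsub>int_vec_group E\<^esub> x = \<one>\<^bsub>int_vec_group E\<^esub>"
    by (intro bexI[of _ "- x"]) (auto simp: int_vec_group_def int_vecs_def rat_vecs_def)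
qed (auto simp: int_vec_group_def int_vecs_def rat_vecs_def algebra_simps)

lemma J_class_eq_coset: "J_class E Cs v = circuit_lattice E Cs #>\<^bsub>int_vec_group E\<^esub> v"
proof -
  have "\<exists>h\<in>circuit_lattice E Cs. w = h + v" if "w - v \<in> circuit_lattice E Cs" for w
    using that by (intro bexI[of _ "w - v"]) auto
  then show ?thesis
    by (auto simp: J_class_def J_equiv_def r_coset_def int_vec_group_def)
qed

lemma carrier_Jac: "carrier (Jac E Cs) = J_class E Cs ` int_vecs E"
  by (simp add: Jac_def carrier_FactGroup J_class_eq_coset int_vec_group_def cong: image_cong)

lemma comm_group_Jac:
  assumes "proj ` Cs \<subseteq> int_vecs E"
  shows "comm_group (Jac E Cs)"
proof -
  interpret comm_group "int_vec_group E" by (rule comm_group_int_vec_group)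
  have "subgroup (circuit_lattice E Cs) (int_vec_group E)"
    unfolding circuit_lattice_def using assms
    by (intro generate_is_subgroup) (simp add: int_vec_group_def)
  then show ?thesis
    unfolding Jac_def by (rule abelian_FactGroup)
qed

end

theory Submission
  imports Defs
begin

text \<open>
  The vectors orthogonal to all signed circuits form a Lagrangian subspace \<open>L\<close>: over a basis \<open>B\<close>
  the fundamental circuits are the rows of \<open>(I | A)\<close> with \<open>A\<close> skew-symmetric, and every \<open>u \<in> L\<close>
  satisfies \<open>\<Sum>e. u e * u e\<^sup>* = 0\<close>. Hence if \<open>u \<in> L\<close> is integral and \<open>\<pi>(u)\<close> is the difference of two
  orientations, then \<open>u\<close> is a \<open>(0,\<plusminus>1)\<close>-vector with subtransversal support, so it is a conformal sum of
  signed circuits with disjoint supports: orientations that are J-equivalent are R-equivalent.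

  Tucker's theorem on skew-symmetric matrices provides, for each sign pattern on \<open>E\<close>, a vector of
  \<open>L\<close> that obeys it and is nonzero on every pair \<open>e, e\<^sup>*\<close>. Decomposing that vector conformally, one finds
  circuits that move any half-integral vector towards an orientation, which gives (1).

  For (2), acyclicity of \<open>\<sigma>\<close> and Gordan's theorem give a linear functional \<open>w\<close> that is positive on \<open>\<sigma>\<close>.
  If \<open>\<beta>(B\<^sub>2) - \<beta>(B\<^sub>1) = \<pi>(u)\<close>, then expanding \<open>u\<close> over \<open>B\<^sub>2\<close> and \<open>-u\<close> over \<open>B\<^sub>1\<close> shows that \<open>w\<close> is positive
  on both unless \<open>u = 0\<close>; the case \<open>\<beta>(B\<^sub>1) = \<beta>(B\<^sub>2)\<close> is excluded by Tucker's theorem on \<open>B\<^sub>1 - B\<^sub>2\<close>.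
  Conversely, an orientation of maximal weight in its class makes a skew-symmetric linear
  complementarity problem feasible, and the zero pattern of a strictly complementary solution is a
  basis \<open>B\<close> for which \<open>\<beta>(B)\<close> is that orientation. Finally, \<open>\<Gamma>([v], B\<^sub>1) = B\<^sub>2\<close> holds exactly when
  \<open>v + \<beta>(B\<^sub>1)\<close> and \<open>\<beta>(B\<^sub>2)\<close> are J-equivalent, a condition that reorientation preserves.
\<close>

section \<open>Theorems of the alternative and skew-symmetric matrices\<close>

text \<open>Induction on the set of generators. If the functional found for the smaller set is
  negative on the new generator \<open>a k\<close>, all vectors are projected along
  \<open>a k\<close> onto its kernel and the induction hypothesis is applied there. The argument is
  purely algebraic, so it works over the rationals.\<close>

lemma farkas:
  fixes a :: "'j \<Rightarrow> 'i \<Rightarrow> 'f::linordered_field"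
  assumes "finite J" and I: "finite I"
  shows "(\<exists>c. (\<forall>j\<in>J. 0 \<le> c j) \<and> (\<forall>i\<in>I. b i = (\<Sum>j\<in>J. c j * a j i))) \<or>
         (\<exists>w. (\<forall>j\<in>J. 0 \<le> (\<Sum>i\<in>I. w i * a j i)) \<and> (\<Sum>i\<in>I. w i * b i) < 0)"
  using assms(1)
proof (induction J arbitrary: a b)
  case empty
  show ?case
  proof (cases "\<forall>i\<in>I. b i = 0")
    case False
    then obtain i where i: "i \<in> I" "b i \<noteq> 0" by blast
    then have "0 < (\<Sum>i\<in>I. b i * b i)"
      by (intro sum_pos2[OF I, of i]) (auto simp: zero_less_mult_iff not_less)
    then have "(\<Sum>i\<in>I. - b i * b i) < 0" by (simp add: sum_negf)
    then show ?thesis by (intro disjI2 exI[of _ "\<lambda>i. - b i"]) simp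
  qed simp
next
  case (insert k J)
  define ip where "ip w v = (\<Sum>i\<in>I. w i * v i)" for w v :: "'i \<Rightarrow> 'f"
  have ip_lin: "ip w (\<lambda>i. u i + r * v i) = ip w u + r * ip w v"
    "ip (\<lambda>i. u i + r * v i) w = ip u w + r * ip v w" for w u v r
    by (auto simp: ip_def sum.distrib sum_distrib_left algebra_simps)
  consider c where "\<forall>j\<in>J. 0 \<le> c j" "\<forall>i\<in>I. b i = (\<Sum>j\<in>J. c j * a j i)"
    | w where "\<forall>j\<in>J. 0 \<le> ip w (a j)" "ip w b < 0"
    using insert.IH[of b a] unfolding ip_def by blast
  then show ?case
  proof cases
    case 1
    have "(\<Sum>j\<in>J. (c(k := 0)) j * a j i) = (\<Sum>j\<in>J. c j * a j i)" for i
      using insert.hyps by (intro sum.cong) auto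
    then show ?thesis using 1 insert.hyps by (intro disjI1 exI[of _ "c(k := 0)"]) auto
  next
    case (2 w)
    show ?thesis
    proof (cases "0 \<le> ip w (a k)")
      case True
      then show ?thesis using 2 by (intro disjI2 exI[of _ w]) (auto simp: ip_def)
    next
      case False
      then have neg: "ip w (a k) < 0" by simp
      \<comment> \<open>Adding \<open>r v\<close> times \<open>a k\<close> to \<open>v\<close> gives
        the projection of \<open>v\<close> along \<open>a k\<close> onto the kernel of
        \<open>w\<close>. The factor is nonnegative for the old generators and negative for
        \<open>b\<close>.\<close>
      define r where "r v = - (ip w v / ip w (a k))" for v
      define a' where "a' j = (\<lambda>i. a j i + r (a j) * a k i)" for j
      define b' where "b' = (\<lambda>i. b i + r b * a k i)"
      have orth: "ip w (a' j) = 0" "ip w b' = 0" for j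
        using neg unfolding a'_def b'_def ip_lin r_def by auto
      have r: "\<forall>j\<in>J. 0 \<le> r (a j)" "r b < 0"
        using 2 neg by (auto simp: r_def divide_nonneg_neg divide_neg_neg divide_le_0_iff)
      consider c where "\<forall>j\<in>J. 0 \<le> c j" "\<forall>i\<in>I. b' i = (\<Sum>j\<in>J. c j * a' j i)"
        | z where "\<forall>j\<in>J. 0 \<le> ip z (a' j)" "ip z b' < 0"
        using insert.IH[of b' a'] unfolding ip_def by blast
      then show ?thesis
      proof cases
        case (1 c)
        \<comment> \<open>The coefficient that \<open>a k\<close> receives when the projections are
          undone.\<close>
        define t where "t = (\<Sum>j\<in>J. c j * r (a j)) - r b"
        have "0 \<le> (\<Sum>j\<in>J. c j * r (a j))" using 1 r by (intro sum_nonneg) auto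
        then have "0 \<le> t" using r by (simp add: t_def)
        have "b i = t * a k i + (\<Sum>j\<in>J. c j * a j i)" if "i \<in> I" for i
        proof -
          have "b i = b' i - r b * a k i" by (simp add: b'_def)
          also have "b' i = (\<Sum>j\<in>J. c j * a' j i)" using 1 that by blast
          also have "\<dots> = (\<Sum>j\<in>J. c j * a j i) + (\<Sum>j\<in>J. c j * r (a j)) * a k i"
            by (simp add: a'_def sum.distrib sum_distrib_right distrib_left mult.assoc)
          finally show ?thesis by (simp add: t_def algebra_simps)
        qed
        moreover have "(\<Sum>j\<in>J. (c(k := t)) j * a j i) = (\<Sum>j\<in>J. c j * a j i)" for i
          using insert.hyps by (intro sum.cong) auto
        ultimately show ?thesis using 1 insert.hyps \<open>0 \<le> t\<close>
          by (intro disjI1 exI[of _ "c(k := t)"]) auto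
      next
        case (2 z)
        \<comment> \<open>Adding a multiple of \<open>w\<close> does not change the values on the
          projected vectors; this multiple makes \<open>y\<close> vanish on \<open>a k\<close>, so
          \<open>y\<close> takes equal values on a vector and on its projection.\<close>
        define y where "y = (\<lambda>i. z i + (- (ip z (a k) / ip w (a k))) * w i)"
        have yk: "ip y (a k) = 0" using neg unfolding y_def ip_lin by simp
        have "ip y (a' j) = ip z (a' j)" "ip y b' = ip z b'" for j
          unfolding y_def ip_lin by (auto simp: orth)
        moreover have "ip y (a' j) = ip y (a j)" "ip y b' = ip y b" for j
          unfolding a'_def b'_def ip_lin by (auto simp: yk)
        ultimately show ?thesis using 2 yk
          by (intro disjI2 exI[of _ y]) (auto simp: ip_def)
      qed
    qed
  qed
qed

text \<open>For each \<open>k\<close>, Farkas' lemma with target \<open>- a k\<close> yields a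
  functional nonnegative on all vectors and positive on \<open>a k\<close>. The sum of these
  functionals is positive everywhere.\<close>

lemma gordan:
  fixes a :: "'j \<Rightarrow> 'i \<Rightarrow> 'f::linordered_field"
  assumes J: "finite J" and I: "finite I"
    and acyclic: "\<And>c. \<lbrakk>\<And>j. j \<in> J \<Longrightarrow> 0 \<le> c j; \<And>i. i \<in> I \<Longrightarrow> (\<Sum>j\<in>J. c j * a j i) = 0\<rbrakk>
      \<Longrightarrow> \<forall>j\<in>J. c j = 0"
  obtains w where "\<And>j. j \<in> J \<Longrightarrow> 0 < (\<Sum>i\<in>I. w i * a j i)"
proof -
  have "\<exists>w. (\<forall>j\<in>J. 0 \<le> (\<Sum>i\<in>I. w i * a j i)) \<and> 0 < (\<Sum>i\<in>I. w i * a k i)" if k: "k \<in> J" for k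
  proof -
    consider c where "\<forall>j\<in>J. 0 \<le> c j" "\<forall>i\<in>I. - a k i = (\<Sum>j\<in>J. c j * a j i)"
      | w where "\<forall>j\<in>J. 0 \<le> (\<Sum>i\<in>I. w i * a j i)" "(\<Sum>i\<in>I. w i * - a k i) < 0"
      using farkas[OF J I, of "\<lambda>i. - a k i" a] by blast
    then show ?thesis
    proof cases
      case (1 c)
      \<comment> \<open>Moving \<open>- a k\<close> to the other side produces a vanishing
        nonnegative combination whose coefficient at \<open>k\<close> is at least 1, contrary to the
        hypothesis.\<close>
      define d where "d j = c j + of_bool (j = k)" for j
      have d: "d j * a j i = c j * a j i + (if j = k then a j i else 0)" for j i
        by (simp add: d_def distrib_right)
      have "(\<Sum>j\<in>J. d j * a j i) = (\<Sum>j\<in>J. c j * a j i) + a k i" for i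
        unfolding d using k J by (simp add: sum.distrib)
      moreover have "(\<Sum>j\<in>J. c j * a j i) + a k i = 0" if "i \<in> I" for i
        using 1(2) that by (metis add.left_inverse)
      moreover have "0 \<le> d j" if "j \<in> J" for j using that 1 by (simp add: d_def)
      ultimately have "\<forall>j\<in>J. d j = 0" by (intro acyclic) simp_all
      then have "c k + 1 = 0" using k by (auto simp: d_def dest: bspec[of _ _ k])
      moreover have "0 \<le> c k" using 1 k by blast
      ultimately show ?thesis by linarith
    next
      case (2 w)
      then show ?thesis by (intro exI[of _ w]) (simp add: sum_negf)
    qed
  qed
  then have "\<exists>W. \<forall>k\<in>J. (\<forall>j\<in>J. 0 \<le> (\<Sum>i\<in>I. W k i * a j i)) \<and> 0 < (\<Sum>i\<in>I. W k i * a k i)"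
    by (intro bchoice) blast
  then obtain W where W: "\<And>k j. k \<in> J \<Longrightarrow> j \<in> J \<Longrightarrow> 0 \<le> (\<Sum>i\<in>I. W k i * a j i)"
    "\<And>k. k \<in> J \<Longrightarrow> 0 < (\<Sum>i\<in>I. W k i * a k i)" by blast
  show thesis
  proof (rule that[of "\<lambda>i. \<Sum>k\<in>J. W k i"])
    fix j assume j: "j \<in> J"
    have "(\<Sum>i\<in>I. (\<Sum>k\<in>J. W k i) * a j i) = (\<Sum>k\<in>J. \<Sum>i\<in>I. W k i * a j i)"
      by (simp add: sum_distrib_right sum.swap[of _ J])
    also have "\<dots> > 0" using W j by (intro sum_pos2[OF J j]) auto
    finally show "0 < (\<Sum>i\<in>I. (\<Sum>k\<in>J. W k i) * a j i)" .
  qed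
qed

section \<open>Skew-symmetric matrices: Tucker's theorem and complementarity\<close>

text \<open>The strict inequality is first obtained for a single index \<open>k\<close> by Farkas'
  lemma, where skewness makes both alternatives useful: a conic combination gives \<open>x\<close>
  with k-th entry of \<open>A x\<close> at least 1, a separating functional gives \<open>x\<close>
  with positive k-th entry. Summing over \<open>k\<close> gives strictness at every index.\<close>

lemma tucker_skew:
  fixes A :: "'i \<Rightarrow> 'i \<Rightarrow> 'f::linordered_field"
  assumes I: "finite I" and skew: "\<And>i j. i \<in> I \<Longrightarrow> j \<in> I \<Longrightarrow> A i j = - A j i"
  obtains x where "\<And>i. i \<in> I \<Longrightarrow> 0 \<le> x i" "\<And>i. i \<in> I \<Longrightarrow> 0 \<le> (\<Sum>j\<in>I. A i j * x j)"
    "\<And>i. i \<in> I \<Longrightarrow> 0 < x i + (\<Sum>j\<in>I. A i j * x j)"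
proof -
  have "\<exists>x. (\<forall>i\<in>I. 0 \<le> x i) \<and> (\<forall>i\<in>I. 0 \<le> (\<Sum>j\<in>I. A i j * x j)) \<and>
      0 < x k + (\<Sum>j\<in>I. A k j * x j)" if k: "k \<in> I" for k
  proof -
    \<comment> \<open>The generators are the unit vectors (\<open>Inl\<close>) and the rows of
      \<open>A\<close> (\<open>Inr\<close>); the target is minus the k-th unit vector.\<close>
    define a where "a = case_sum (\<lambda>i j. of_bool (i = j)) A"
    have J: "finite (I <+> I)" using I by simp
    consider c where "\<forall>j\<in>I <+> I. 0 \<le> c j" "\<forall>i\<in>I. - of_bool (k = i) = (\<Sum>j\<in>I <+> I. c j * a j i)"
      | w where "\<forall>j\<in>I <+> I. 0 \<le> (\<Sum>i\<in>I. w i * a j i)" "(\<Sum>i\<in>I. w i * - of_bool (k = i)) < 0"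
      using farkas[OF J I, of "\<lambda>i. - of_bool (k = i)" a] by blast
    then show ?thesis
    proof cases
      case (1 c)
      define x where "x = c \<circ> Inr"
      have "(\<Sum>j\<in>I. A i j * x j) = c (Inl i) + of_bool (k = i)" if i: "i \<in> I" for i
      proof -
        have "- of_bool (k = i) = (\<Sum>j\<in>I. c (Inl j) * of_bool (j = i)) + (\<Sum>j\<in>I. x j * A j i)"
          using 1 i I by (simp add: sum.Plus a_def x_def)
        also have "(\<Sum>j\<in>I. c (Inl j) * of_bool (j = i)) = c (Inl i)"
          using i I by (simp add: of_bool_def if_distrib cong: if_cong)
        also have "(\<Sum>j\<in>I. x j * A j i) = - (\<Sum>j\<in>I. A i j * x j)"
          unfolding sum_negf[symmetric] using skew[OF _ i]
          by (intro sum.cong refl) (metis minus_mult_left mult.commute)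
        finally show ?thesis by (simp add: algebra_simps)
      qed
      moreover have "\<forall>i\<in>I. 0 \<le> c (Inl i) \<and> 0 \<le> x i" using 1 by (auto simp: x_def)
      ultimately show ?thesis using k by (intro exI[of _ x]) (auto simp: add_nonneg_pos)
    next
      case (2 w)
      have "0 \<le> w i" if "i \<in> I" for i
        using that 2(1)[rule_format, OF InlI, of i] I
        by (simp add: a_def of_bool_def if_distrib cong: if_cong)
      moreover have "0 \<le> (\<Sum>j\<in>I. A i j * w j)" if "i \<in> I" for i
        using that 2(1)[rule_format, OF InrI, of i] by (simp add: a_def mult.commute)
      moreover have "0 < w k"
        using 2(2) k I by (simp add: of_bool_def sum_negf if_distrib cong: if_cong)
      ultimately show ?thesis using k by (intro exI[of _ w]) (auto simp: add_pos_nonneg)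
    qed
  qed
  then have "\<exists>X. \<forall>k\<in>I. (\<forall>i\<in>I. 0 \<le> X k i) \<and> (\<forall>i\<in>I. 0 \<le> (\<Sum>j\<in>I. A i j * X k j)) \<and>
      0 < X k k + (\<Sum>j\<in>I. A k j * X k j)" by (intro bchoice) blast
  then obtain X where X: "\<And>k i. k \<in> I \<Longrightarrow> i \<in> I \<Longrightarrow> 0 \<le> X k i"
    "\<And>k i. k \<in> I \<Longrightarrow> i \<in> I \<Longrightarrow> 0 \<le> (\<Sum>j\<in>I. A i j * X k j)"
    "\<And>k. k \<in> I \<Longrightarrow> 0 < X k k + (\<Sum>j\<in>I. A k j * X k j)" by blast
  have eq: "(\<Sum>j\<in>I. A i j * (\<Sum>k\<in>I. X k j)) = (\<Sum>k\<in>I. \<Sum>j\<in>I. A i j * X k j)" for i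
    unfolding sum_distrib_left by (rule sum.swap)
  show thesis
  proof (rule that[of "\<lambda>i. \<Sum>k\<in>I. X k i"], goal_cases)
    case (3 i)
    have "0 < (\<Sum>k\<in>I. X k i + (\<Sum>j\<in>I. A i j * X k j))"
      using X 3 by (intro sum_pos2[OF I 3]) auto
    then show ?case by (simp add: eq sum.distrib)
  qed (simp_all add: eq sum_nonneg X)
qed

text \<open>Homogenise with one extra index \<open>None\<close>: the skew matrix \<open>(A, q; -q\<^sup>T, 0)\<close>.\<close>

lemma skew_complementarity:
  fixes A :: "'i \<Rightarrow> 'i \<Rightarrow> 'f::linordered_field"
  assumes I: "finite I" and skew: "\<And>i j. i \<in> I \<Longrightarrow> j \<in> I \<Longrightarrow> A i j = - A j i"
    and feasible: "\<And>x. \<lbrakk>\<And>i. i \<in> I \<Longrightarrow> 0 \<le> x i; \<And>i. i \<in> I \<Longrightarrow> 0 \<le> (\<Sum>j\<in>I. A i j * x j)\<rbrakk>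
      \<Longrightarrow> 0 \<le> (\<Sum>i\<in>I. q i * x i)"
  obtains x y where "\<And>i. i \<in> I \<Longrightarrow> y i = q i + (\<Sum>j\<in>I. A i j * x j)"
    "\<And>i. i \<in> I \<Longrightarrow> 0 \<le> x i" "\<And>i. i \<in> I \<Longrightarrow> 0 \<le> y i"
    "\<And>i. i \<in> I \<Longrightarrow> (x i = 0) \<noteq> (y i = 0)"
proof -
  define A' where "A' i j = (case (i, j) of (Some i, Some j) \<Rightarrow> A i j | (Some i, None) \<Rightarrow> q i
    | (None, Some j) \<Rightarrow> - q j | (None, None) \<Rightarrow> 0)" for i j
  define I' where "I' = insert None (Some ` I)"
  have sum': "(\<Sum>j\<in>I'. f j) = f None + (\<Sum>j\<in>I. f (Some j))" for f :: "'i option \<Rightarrow> 'f"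
    using I by (simp add: I'_def sum.reindex)
  obtain x' where x': "\<And>i. i \<in> I' \<Longrightarrow> 0 \<le> x' i" "\<And>i. i \<in> I' \<Longrightarrow> 0 \<le> (\<Sum>j\<in>I'. A' i j * x' j)"
    "\<And>i. i \<in> I' \<Longrightarrow> 0 < x' i + (\<Sum>j\<in>I'. A' i j * x' j)"
  proof (rule tucker_skew[of I' A'])
    show "finite I'" using I by (simp add: I'_def)
    show "A' i j = - A' j i" if "i \<in> I'" "j \<in> I'" for i j
      using that skew[of "the i" "the j"] by (auto simp: I'_def A'_def)
  qed blast
  \<comment> \<open>The homogenising coordinate. The row \<open>None\<close> says that
    \<open>q\<close> applied to the solution is at most 0 and less than \<open>t\<close>, so
    \<open>t = 0\<close> would contradict \<open>feasible\<close>; hence the solution can be divided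
    by \<open>t\<close>.\<close>
  define t where "t = x' None"
  have t: "0 \<le> t" "(\<Sum>j\<in>I. q j * x' (Some j)) \<le> 0" "(\<Sum>j\<in>I. q j * x' (Some j)) < t"
    using x'[of None] by (auto simp: I'_def A'_def sum'[unfolded I'_def] t_def sum_negf)
  have S: "0 \<le> x' (Some i)" "0 \<le> q i * t + (\<Sum>j\<in>I. A i j * x' (Some j))"
    "0 < x' (Some i) + (q i * t + (\<Sum>j\<in>I. A i j * x' (Some j)))" if "i \<in> I" for i
    using x'[of "Some i"] that by (auto simp: I'_def A'_def sum'[unfolded I'_def] t_def)
  have "0 < t"
  proof (rule ccontr)
    assume "\<not> 0 < t"
    then have "t = 0" using t by simp
    then show False using t(3) feasible[of "\<lambda>i. x' (Some i)"] S by fastforce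
  qed
  define x where "x i = x' (Some i) / t" for i
  define y where "y i = q i + (\<Sum>j\<in>I. A i j * x j)" for i
  have y: "y i = (q i * t + (\<Sum>j\<in>I. A i j * x' (Some j))) / t" for i
    using \<open>0 < t\<close> by (simp add: y_def x_def add_divide_distrib sum_divide_distrib)
  have nonneg: "0 \<le> x i" "0 \<le> y i" "0 < x i + y i" if "i \<in> I" for i
    using S[OF that] \<open>0 < t\<close> by (auto simp: x_def y add_divide_distrib[symmetric])
  \<comment> \<open>The quadratic form of a skew matrix vanishes. The inner product of
    \<open>x\<close> and \<open>y\<close> therefore equals that of \<open>q\<close> and
    \<open>x\<close>, which is at most 0; as all terms are nonnegative, each product
    \<open>x i * y i\<close> is 0.\<close>
  have "(\<Sum>i\<in>I. \<Sum>j\<in>I. x i * A i j * x j) = (\<Sum>i\<in>I. \<Sum>j\<in>I. - (x i * A i j * x j))"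
  proof -
    have "(\<Sum>i\<in>I. \<Sum>j\<in>I. x i * A i j * x j) = (\<Sum>j\<in>I. \<Sum>i\<in>I. x i * A i j * x j)"
      by (rule sum.swap)
    also have "\<dots> = (\<Sum>i\<in>I. \<Sum>j\<in>I. - (x i * A i j * x j))"
    proof (intro sum.cong refl)
      fix i j assume "i \<in> I" "j \<in> I"
      then show "x j * A j i * x i = - (x i * A i j * x j)" using skew[of i j] by simp
    qed
    finally show ?thesis .
  qed
  then have xAx: "(\<Sum>i\<in>I. \<Sum>j\<in>I. x i * A i j * x j) = 0" by (simp add: sum_negf)
  have "(\<Sum>i\<in>I. x i * y i) = (\<Sum>i\<in>I. q i * x i) + (\<Sum>i\<in>I. \<Sum>j\<in>I. x i * A i j * x j)"
    by (simp add: y_def algebra_simps sum.distrib sum_distrib_left)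
  also have "\<dots> \<le> 0"
    unfolding xAx using t(2) \<open>0 < t\<close>
    by (simp add: x_def sum_divide_distrib[symmetric] divide_le_0_iff)
  finally have "(\<Sum>i\<in>I. x i * y i) = 0"
    using nonneg by (intro antisym sum_nonneg) auto
  then have "\<forall>i\<in>I. x i * y i = 0" using nonneg I by (subst (asm) sum_nonneg_eq_0_iff) auto
  then have "(x i = 0) \<noteq> (y i = 0)" if "i \<in> I" for i using nonneg(3)[OF that] that by fastforce
  then show thesis using nonneg by (intro that[of y x]) (auto simp: y_def)
qed


section \<open>The Lagrangian subspace of a representation\<close>

lemma star_star [simp]: "star (star x) = x"
  by (cases x) auto

lemma star_neq [simp]: "star x \<noteq> x" "x \<noteq> star x"
  by (cases x; simp)+

lemma star_in_ground_iff [simp]: "star x \<in> E <+> E \<longleftrightarrow> x \<in> E <+> E"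
  by (cases x) auto

lemma Inl_in_ground_iff [simp]: "Inl e \<in> E <+> E \<longleftrightarrow> e \<in> E"
  and Inr_in_ground_iff [simp]: "Inr e \<in> E <+> E \<longleftrightarrow> e \<in> E"
  by auto

definition base :: "'a + 'a \<Rightarrow> 'a" where
  "base = case_sum id id"

lemma base_simps [simp]: "base (Inl e) = e" "base (Inr e) = e" "base (star x) = base x"
  by (cases x; simp add: base_def)+

lemma base_in_iff [simp]: "base x \<in> E \<longleftrightarrow> x \<in> E <+> E"
  by (cases x) auto

lemma inj_star: "inj_on star A"
  by (metis inj_onI star_star)

text \<open>On a set without a pair \<open>x, star x\<close> the map \<open>base\<close> is
  injective, so having \<open>card E\<close> elements means meeting every pair. This replaces the
  cardinality condition by a pointwise one.\<close>

lemma transversal_iff: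
  assumes "finite E"
  shows "transversal E T \<longleftrightarrow> T \<subseteq> E <+> E \<and> (\<forall>x\<in>E <+> E. star x \<in> T \<longleftrightarrow> x \<notin> T)"
proof (cases "T \<subseteq> E <+> E \<and> (\<forall>x\<in>T. star x \<notin> T)")
  case True
  have base_eq: "base x = base y \<longleftrightarrow> y = x \<or> y = star x" for x y
    by (cases x; cases y) auto
  have inj: "inj_on base T" using True by (auto simp: inj_on_def base_eq)
  have sub: "base ` T \<subseteq> E" using True by auto
  have "card T = card E \<longleftrightarrow> base ` T = E"
    using card_image[OF inj] card_subset_eq[OF assms sub] by auto
  also have "\<dots> \<longleftrightarrow> (\<forall>e\<in>E. e \<in> base ` T)" using sub by auto
  also have "\<dots> \<longleftrightarrow> (\<forall>e\<in>E. Inl e \<in> T \<or> Inr e \<in> T)"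
  proof -
    have "base y = e \<longleftrightarrow> y = Inl e \<or> y = Inr e" for y e by (cases y) auto
    then have "e \<in> base ` T \<longleftrightarrow> Inl e \<in> T \<or> Inr e \<in> T" for e by (metis image_iff)
    then show ?thesis by simp
  qed
  also have "\<dots> \<longleftrightarrow> (\<forall>x\<in>E <+> E. x \<in> T \<or> star x \<in> T)" by (auto simp: Plus_def)
  finally show ?thesis using True unfolding transversal_def by blast
next
  case False
  then show ?thesis by (auto simp: transversal_def)
qed

text \<open>The ground set is the disjoint union of the complement of \<open>T\<close> and its image
  under \<open>star\<close>. For a basis these are the free and the dependent coordinates.\<close>

lemma sum_cotransversal:
  assumes "finite E" "transversal E T"
  shows "(\<Sum>x\<in>E <+> E. f x) = (\<Sum>x\<in>(E <+> E) - T. f x + f (star x))"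
proof -
  let ?N = "(E <+> E) - T"
  have T: "T = star ` ?N"
  proof
    show "T \<subseteq> star ` ?N"
    proof
      fix x assume "x \<in> T"
      then have "star x \<in> ?N" using assms by (auto simp: transversal_iff)
      then show "x \<in> star ` ?N" by (metis imageI star_star)
    qed
  qed (use assms in \<open>auto simp: transversal_iff\<close>)
  have "(\<Sum>x\<in>E <+> E. f x) = (\<Sum>x\<in>?N. f x) + (\<Sum>x\<in>T. f x)"
    using assms by (subst sum.subset_diff[of T]) (auto simp: transversal_iff)
  also have "(\<Sum>x\<in>T. f x) = (\<Sum>x\<in>?N. f (star x))"
    by (subst T) (simp add: sum.reindex[OF inj_star])
  finally show ?thesis by (simp add: sum.distrib)
qed

lemma supp_uminus [simp]: "supp (- v) = supp v"
  by (simp add: supp_def)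

text \<open>The strict inequality says at once that the support of \<open>c\<close> lies in that of
  \<open>u\<close> and that the signs agree there.\<close>

definition conformal :: "('i \<Rightarrow> rat) \<Rightarrow> ('i \<Rightarrow> rat) \<Rightarrow> bool" where
  "conformal c u \<longleftrightarrow> (\<forall>x. c x \<noteq> 0 \<longrightarrow> 0 < c x * u x)"

lemma conformal_trans: "conformal a b \<Longrightarrow> conformal b c \<Longrightarrow> conformal a c"
  unfolding conformal_def by (metis (no_types, lifting) less_irrefl mult_zero_right
    zero_less_mult_iff less_asym)

section \<open>Signed circuits and bases\<close>

locale regular_orthogonal_representation = orthogonal_matroid E Bs
  for E :: "'a set" and Bs :: "('a + 'a) set set" +
  fixes Cs :: "('a + 'a \<Rightarrow> rat) set"
  assumes representation: "regular_representation E Bs Cs"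
begin

lemma finite_ground_sum: "finite (E <+> E)"
  using finite_ground by simp

lemma circuit_entry: "C \<in> Cs \<Longrightarrow> C x = 0 \<or> C x = 1 \<or> C x = -1"
  using representation by (auto simp: regular_representation_def)

lemma circuit_outside: "C \<in> Cs \<Longrightarrow> x \<notin> E <+> E \<Longrightarrow> C x = 0"
  using representation by (auto simp: regular_representation_def int_vecs_def rat_vecs_def)

lemma uminus_circuit: "C \<in> Cs \<Longrightarrow> - C \<in> Cs"
  using representation unfolding regular_representation_def by (metis imageI)

lemma supp_image: "supp ` Cs = {K. circuit E Bs K}"
  using representation by (simp add: regular_representation_def)

lemma circuit_supp: "C \<in> Cs \<Longrightarrow> circuit E Bs (supp C)"
  using supp_image by blast

lemma circuit_vector:
  assumes "circuit E Bs K"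
  obtains C where "C \<in> Cs" "supp C = K"
  using assms supp_image by (metis (mono_tags, lifting) imageE mem_Collect_eq)

lemma pairing_circuits: "C \<in> Cs \<Longrightarrow> D \<in> Cs \<Longrightarrow> pairing E C D = 0"
  using representation by (simp add: regular_representation_def)

lemma finite_Cs: "finite Cs"
proof (rule finite_subset)
  show "Cs \<subseteq> {f. \<forall>x. (x \<in> E <+> E \<longrightarrow> f x \<in> {0, 1, -1}) \<and> (x \<notin> E <+> E \<longrightarrow> f x = 0)}"
    using circuit_entry circuit_outside by fastforce
  show "finite {f. \<forall>x. (x \<in> E <+> E \<longrightarrow> f x \<in> {0, 1, -1 :: rat}) \<and> (x \<notin> E <+> E \<longrightarrow> f x = 0)}"
    by (rule finite_set_of_finite_funs[OF finite_ground_sum]) simp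
qed

lemma basis_iff: "B \<in> Bs \<Longrightarrow> x \<in> E <+> E \<Longrightarrow> star x \<in> B \<longleftrightarrow> x \<notin> B"
  using bases_transversal finite_ground by (auto simp: transversal_iff)

lemma basis_subset: "B \<in> Bs \<Longrightarrow> B \<subseteq> E <+> E"
  using bases_transversal by (auto simp: transversal_def)

lemma circuit_exists:
  assumes "subtransversal E S" "\<forall>B\<in>Bs. \<not> S \<subseteq> B"
  shows "\<exists>K. circuit E Bs K \<and> K \<subseteq> S"
proof -
  obtain T where "S \<subseteq> T" "T \<subseteq> E <+> E"
    using assms(1) by (auto simp: subtransversal_def transversal_def)
  then have "finite S" using finite_subset[OF _ finite_ground_sum, of S] by simp
  then show ?thesis using assms
  proof (induction S rule: finite_psubset_induct)
    case (psubset S)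
    show ?case
    proof (cases "circuit E Bs S")
      case False
      then obtain S' where S': "S' \<subset> S" "subtransversal E S'" "\<forall>B\<in>Bs. \<not> S' \<subseteq> B"
        using psubset.prems unfolding circuit_def by metis
      obtain K where "circuit E Bs K" "K \<subseteq> S'" using psubset.IH[OF S'] by metis
      then show ?thesis using S'(1) by (intro exI[of _ K]) auto
    qed auto
  qed
qed

lemma flip_eq:
  assumes "B \<in> Bs" "x \<in> (E <+> E) - B"
  shows "sym_diff B {x, star x} = insert x (B - {star x})"
  using basis_iff[of B x] assms by auto

text \<open>Exchange forces any two bases to differ in an even number of elements.\<close>

lemma flip_not_basis:
  assumes B: "B \<in> Bs" and x: "x \<in> (E <+> E) - B"
  shows "transversal E (sym_diff B {x, star x})" "\<forall>B'\<in>Bs. \<not> sym_diff B {x, star x} \<subseteq> B'"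
proof -
  have xB: "star x \<in> B" using basis_iff[OF B, of x] x by auto
  let ?T = "insert x (B - {star x})"
  show "transversal E (sym_diff B {x, star x})"
    unfolding flip_eq[OF assms] transversal_iff[OF finite_ground]
  proof (intro conjI ballI)
    fix y assume y: "y \<in> E <+> E"
    show "star y \<in> ?T \<longleftrightarrow> y \<notin> ?T"
      using basis_iff[OF B y] x xB by (metis Diff_iff insert_iff singletonD star_star star_neq(1))
  qed (use x basis_subset[OF B] in auto)
  then have T: "transversal E ?T" by (simp add: flip_eq[OF assms])
  show "\<forall>B'\<in>Bs. \<not> sym_diff B {x, star x} \<subseteq> B'"
    unfolding flip_eq[OF assms]
  proof (intro ballI notI)
    fix B' assume B': "B' \<in> Bs" "?T \<subseteq> B'"
    have "finite B'" using basis_subset[OF B'(1)] finite_ground_sum finite_subset by blast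
    then have "B' = ?T"
      using B' T bases_transversal[OF B'(1)] card_subset_eq[of B' ?T]
      by (auto simp: transversal_def)
    then have "B - B' = {star x}" using xB x by auto
    then show False using exchange[OF B B'(1), of "star x"] by auto
  qed
qed

section \<open>The orthogonal complement of the circuits\<close>

text \<open>As an orthogonal complement it is visibly closed under linear combinations;
  \<open>lagrangian_expand\<close> shows that it is also the rational span of
  \<open>Cs\<close>.\<close>

definition lagrangian :: "('a + 'a \<Rightarrow> rat) set" where
  "lagrangian = {u \<in> rat_vecs (E <+> E). \<forall>C\<in>Cs. pairing E u C = 0}"

lemma lagrangian_outside: "u \<in> lagrangian \<Longrightarrow> x \<notin> E <+> E \<Longrightarrow> u x = 0"
  by (auto simp: lagrangian_def rat_vecs_def)

lemma circuit_in_lagrangian: "C \<in> Cs \<Longrightarrow> C \<in> lagrangian"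
  using circuit_outside pairing_circuits by (auto simp: lagrangian_def rat_vecs_def)

lemma lagrangian_lincomb:
  "u \<in> lagrangian \<Longrightarrow> v \<in> lagrangian \<Longrightarrow> (\<lambda>x. a * u x + b * v x) \<in> lagrangian"
  by (auto simp: lagrangian_def rat_vecs_def pairing_def distrib_right mult.assoc sum.distrib
      sum_distrib_left[symmetric])

lemma lagrangian_zero: "(\<lambda>x. 0) \<in> lagrangian"
  by (auto simp: lagrangian_def rat_vecs_def pairing_def)

lemma lagrangian_sum:
  "finite J \<Longrightarrow> (\<And>j. j \<in> J \<Longrightarrow> F j \<in> lagrangian) \<Longrightarrow> (\<lambda>x. \<Sum>j\<in>J. a j * F j x) \<in> lagrangian"
proof (induction J rule: finite_induct)
  case (insert j J)
  then show ?case using lagrangian_lincomb[of "F j" "\<lambda>x. \<Sum>j\<in>J. a j * F j x" "a j" 1] by simp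
qed (simp add: lagrangian_zero)

lemma lagrangian_add: "u \<in> lagrangian \<Longrightarrow> v \<in> lagrangian \<Longrightarrow> u + v \<in> lagrangian"
  using lagrangian_lincomb[of u v 1 1] by (simp add: plus_fun_def)

lemma lagrangian_uminus: "u \<in> lagrangian \<Longrightarrow> - u \<in> lagrangian"
  using lagrangian_lincomb[of u u "-1" 0] by (simp add: fun_Compl_def)

lemma lagrangian_diff: "u \<in> lagrangian \<Longrightarrow> v \<in> lagrangian \<Longrightarrow> u - v \<in> lagrangian"
  using lagrangian_lincomb[of u v 1 "-1"] by (simp add: fun_diff_def)

section \<open>Coordinates with respect to a basis\<close>

text \<open>The signed fundamental circuits, normalised to have entry 1 at \<open>x\<close>. They
  are the rows of \<open>(I | A)\<close>, with the identity block on the columns outside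
  \<open>B\<close>.\<close>

definition fundamental :: "('a + 'a) set \<Rightarrow> ('a + 'a \<Rightarrow> 'a + 'a \<Rightarrow> rat) \<Rightarrow> bool" where
  "fundamental B F \<longleftrightarrow> (\<forall>x\<in>(E <+> E) - B. F x \<in> Cs \<and> supp (F x) \<subseteq> sym_diff B {x, star x} \<and>
     (\<forall>y\<in>(E <+> E) - B. F x y = of_bool (y = x)))"

lemma circuit_not_in_basis: "circuit E Bs K \<Longrightarrow> B \<in> Bs \<Longrightarrow> \<not> K \<subseteq> B"
  by (auto simp: circuit_def)

lemma flip_circuit_entry:
  assumes B: "B \<in> Bs" and x: "x \<in> (E <+> E) - B" and C: "C \<in> Cs"
    and K: "supp C \<subseteq> sym_diff B {x, star x}"
  shows "C x \<noteq> 0" "\<forall>y\<in>(E <+> E) - B. y \<noteq> x \<longrightarrow> C y = 0"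
proof -
  show "C x \<noteq> 0"
    using circuit_not_in_basis[OF circuit_supp[OF C] B] K
    unfolding flip_eq[OF B x] supp_def by auto
  show "\<forall>y\<in>(E <+> E) - B. y \<noteq> x \<longrightarrow> C y = 0"
    using K unfolding flip_eq[OF B x] supp_def by auto
qed

text \<open>The flipped transversal is contained in no basis, so it contains a circuit. That circuit
  uses \<open>x\<close>, as it would otherwise lie in \<open>B\<close>; its sign can be chosen so
  that the entry at \<open>x\<close> is 1.\<close>

lemma fundamental_exists:
  assumes B: "B \<in> Bs"
  obtains F where "fundamental B F"
proof -
  have "\<exists>C. C \<in> Cs \<and> supp C \<subseteq> sym_diff B {x, star x} \<and>
      (\<forall>y\<in>(E <+> E) - B. C y = of_bool (y = x))" if x: "x \<in> (E <+> E) - B" for x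
  proof -
    have "subtransversal E (sym_diff B {x, star x})"
      using flip_not_basis(1)[OF B x] unfolding subtransversal_def by blast
    then obtain K where K: "circuit E Bs K" "K \<subseteq> sym_diff B {x, star x}"
      using circuit_exists flip_not_basis(2)[OF B x] by blast
    obtain C where C: "C \<in> Cs" "supp C = K" using circuit_vector[OF K(1)] .
    note e = flip_circuit_entry[OF B x C(1) K(2)[folded C(2)]]
    show ?thesis
    proof (cases "C x = 1")
      case True
      then show ?thesis using C K e by (intro exI[of _ C]) auto
    next
      case False
      then have "C x = -1" using circuit_entry[OF C(1), of x] e by auto
      then show ?thesis using C K e uminus_circuit by (intro exI[of _ "- C"]) auto
    qed
  qed
  then show thesis using that unfolding fundamental_def by metis
qed

lemma fundamental_in_Cs: "fundamental B F \<Longrightarrow> x \<in> (E <+> E) - B \<Longrightarrow> F x \<in> Cs"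
  by (auto simp: fundamental_def)

lemma fundamental_delta:
  "fundamental B F \<Longrightarrow> x \<in> (E <+> E) - B \<Longrightarrow> y \<in> (E <+> E) - B \<Longrightarrow> F x y = of_bool (y = x)"
  by (auto simp: fundamental_def)

lemma pairing_basis:
  assumes "B \<in> Bs"
  shows "pairing E u v = (\<Sum>x\<in>(E <+> E) - B. u x * v (star x) + u (star x) * v x)"
  unfolding pairing_def
  by (subst sum_cotransversal[OF finite_ground bases_transversal[OF assms]]) simp

lemma pairing_fundamental:
  assumes B: "B \<in> Bs" and F: "fundamental B F" and y: "y \<in> (E <+> E) - B"
  shows "pairing E u (F y) = (\<Sum>x\<in>(E <+> E) - B. u x * F y (star x)) + u (star y)"
proof -
  have "(\<Sum>x\<in>(E <+> E) - B. u (star x) * F y x) = (\<Sum>x\<in>(E <+> E) - B. if x = y then u (star y) else 0)"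
    using fundamental_delta[OF F y] by (intro sum.cong) auto
  also have "\<dots> = u (star y)" using y finite_ground_sum by (simp add: sum.delta)
  finally show ?thesis by (simp add: pairing_basis[OF B] sum.distrib)
qed

text \<open>Pairing with \<open>F y\<close> isolates the entry \<open>u (star y)\<close>, so the
  entries on \<open>B\<close> are determined by those off \<open>B\<close>.\<close>

lemma lagrangian_eq_0:
  assumes B: "B \<in> Bs" and u: "u \<in> lagrangian" and zero: "\<forall>x\<in>(E <+> E) - B. u x = 0"
  shows "u = (\<lambda>x. 0)"
proof
  fix z
  obtain F where F: "fundamental B F" using fundamental_exists[OF B] .
  have "u (star y) = 0" if y: "y \<in> (E <+> E) - B" for y
    using pairing_fundamental[OF B F y, of u] u fundamental_in_Cs[OF F y] zero
    by (simp add: lagrangian_def)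
  from this[of "star z"] show "u z = 0"
    using zero lagrangian_outside[OF u, of z] basis_iff[OF B, of z] by (cases "z \<in> B") auto
qed

text \<open>Both sides are Lagrangian and agree off \<open>B\<close>, so their difference is
  zero.\<close>

lemma lagrangian_expand:
  assumes B: "B \<in> Bs" and F: "fundamental B F" and u: "u \<in> lagrangian"
  shows "u z = (\<Sum>x\<in>(E <+> E) - B. u x * F x z)"
proof -
  let ?N = "(E <+> E) - B"
  define v where "v = (\<lambda>z. \<Sum>x\<in>?N. u x * F x z)"
  have v: "v \<in> lagrangian"
    unfolding v_def using finite_ground_sum fundamental_in_Cs[OF F] circuit_in_lagrangian
    by (intro lagrangian_sum) auto
  have "v y = u y" if y: "y \<in> ?N" for y
  proof -
    have "v y = (\<Sum>x\<in>?N. if x = y then u y else 0)"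
      unfolding v_def using fundamental_delta[OF F _ y] by (intro sum.cong) auto
    then show ?thesis using y finite_ground_sum by simp
  qed
  then have "u - v = (\<lambda>x. 0)"
    by (intro lagrangian_eq_0[OF B lagrangian_diff[OF u v]]) simp
  then have "u z - v z = 0" by (metis fun_diff_def)
  then show ?thesis by (simp add: v_def)
qed

text \<open>Only two terms survive in the orthogonality relation between \<open>F x\<close> and
  \<open>F y\<close>. This is the skew-symmetry of the block \<open>A\<close>.\<close>

lemma fundamental_skew:
  assumes B: "B \<in> Bs" and F: "fundamental B F" and x: "x \<in> (E <+> E) - B" and y: "y \<in> (E <+> E) - B"
  shows "F x (star y) = - F y (star x)"
proof -
  have "pairing E (F x) (F y) = 0"
    using pairing_circuits fundamental_in_Cs[OF F] x y by blast
  moreover have "(\<Sum>z\<in>(E <+> E) - B. F x z * F y (star z)) =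
      (\<Sum>z\<in>(E <+> E) - B. if z = x then F y (star x) else 0)"
    using fundamental_delta[OF F x] by (intro sum.cong) auto
  ultimately show ?thesis
    using x finite_ground_sum by (simp add: pairing_fundamental[OF B F y] algebra_simps)
qed

lemma obtain_basis: obtains B where "B \<in> Bs"
  using bases_nonempty by blast

section \<open>Isotropy and complementary supports\<close>

text \<open>Expanding one factor shows that \<open>u\<close> is a combination of circuits, to all of
  which \<open>u\<close> is orthogonal; hence \<open>u\<close> is orthogonal to itself. The pairing
  counts every pair twice.\<close>

lemma lagrangian_isotropic:
  assumes u: "u \<in> lagrangian"
  shows "(\<Sum>e\<in>E. u (Inl e) * u (Inr e)) = 0"
proof -
  obtain B where B: "B \<in> Bs" using obtain_basis .
  obtain F where F: "fundamental B F" using fundamental_exists[OF B] .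
  have "pairing E u u = (\<Sum>z\<in>E <+> E. \<Sum>x\<in>(E <+> E) - B. u x * (u z * F x (star z)))"
    unfolding pairing_def
    by (subst (2) lagrangian_expand[OF B F u]) (simp add: sum_distrib_left mult_ac)
  also have "\<dots> = (\<Sum>x\<in>(E <+> E) - B. u x * pairing E u (F x))"
    unfolding pairing_def sum_distrib_left by (rule sum.swap)
  also have "\<dots> = 0"
    using u fundamental_in_Cs[OF F] by (intro sum.neutral) (auto simp: lagrangian_def)
  finally have "2 * (\<Sum>e\<in>E. u (Inl e) * u (Inr e)) = 0"
    using finite_ground by (simp add: pairing_def sum.Plus mult.commute)
  then show ?thesis by simp
qed

text \<open>The terms of the isotropy sum all have one sign and add up to zero, so each of them
  vanishes.\<close>

lemma isotropic_complementary:
  assumes u: "u \<in> lagrangian" and le: "\<And>e. e \<in> E \<Longrightarrow> u (Inl e) * u (Inr e) \<le> 0"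
  shows "u x = 0 \<or> u (star x) = 0"
proof -
  have "\<forall>e\<in>E. - (u (Inl e) * u (Inr e)) = 0"
    using lagrangian_isotropic[OF u] le finite_ground
    by (subst sum_nonneg_eq_0_iff[symmetric]) (auto simp: sum_negf)
  then show ?thesis using lagrangian_outside[OF u, of x] by (cases x) auto
qed

lemma isotropic_complementary':
  assumes u: "u \<in> lagrangian" and le: "\<And>e. e \<in> E \<Longrightarrow> 0 \<le> u (Inl e) * u (Inr e)"
  shows "u x = 0 \<or> u (star x) = 0"
proof -
  have "\<forall>e\<in>E. u (Inl e) * u (Inr e) = 0"
    using lagrangian_isotropic[OF u] le finite_ground
    by (subst sum_nonneg_eq_0_iff[symmetric]) auto
  then show ?thesis using lagrangian_outside[OF u, of x] by (cases x) auto
qed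

text \<open>A zero projection makes the entries of each pair opposite, so their products are
  nonpositive and isotropy applies.\<close>

lemma proj_inj:
  assumes u: "u \<in> lagrangian" and "proj u = 0"
  shows "u = (\<lambda>x. 0)"
proof -
  have eq: "u (Inr e) = - u (Inl e)" for e
    using fun_cong[OF assms(2), of e] by (simp add: proj_def eq_neg_iff_add_eq_0 add.commute)
  have "u x = 0" for x
    using isotropic_complementary[OF u, of x] eq by (cases x) auto
  then show ?thesis by auto
qed

text \<open>A support without pairs is a subtransversal. It lies in no basis, because a Lagrangian
  vector vanishing off a basis is zero.\<close>

lemma support_contains_circuit:
  assumes u: "u \<in> lagrangian" and nz: "u \<noteq> (\<lambda>x. 0)" and compl: "\<And>x. u x = 0 \<or> u (star x) = 0"
  obtains C where "C \<in> Cs" "supp C \<subseteq> supp u"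
proof -
  \<comment> \<open>The support is completed to a transversal by taking \<open>Inl e\<close>
    wherever \<open>Inr e\<close> is not in the support.\<close>
  define T where "T = supp u \<union> {Inl e |e. e \<in> E \<and> u (Inr e) = 0}"
  have "transversal E T"
    unfolding transversal_iff[OF finite_ground]
  proof (intro conjI ballI)
    have "supp u \<subseteq> E <+> E"
      using lagrangian_outside[OF u] unfolding supp_def by (metis (mono_tags) mem_Collect_eq subsetI)
    then show "T \<subseteq> E <+> E" by (auto simp: T_def)
    fix x assume "x \<in> E <+> E"
    then show "star x \<in> T \<longleftrightarrow> x \<notin> T"
      using compl[of x] by (cases x) (auto simp: T_def supp_def)
  qed
  then have "subtransversal E (supp u)" unfolding subtransversal_def T_def by blast
  moreover have "\<not> supp u \<subseteq> B" if B: "B \<in> Bs" for B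
  proof
    assume "supp u \<subseteq> B"
    then have "\<forall>x\<in>(E <+> E) - B. u x = 0" by (auto simp: supp_def)
    then show False using lagrangian_eq_0[OF B u] nz by simp
  qed
  ultimately obtain K where "circuit E Bs K" "K \<subseteq> supp u" using circuit_exists by blast
  then show thesis using that circuit_vector by metis
qed

lemma circuit_nonzero: "C \<in> Cs \<Longrightarrow> \<exists>x. C x \<noteq> 0"
  using circuit_not_in_basis[OF circuit_supp] bases_nonempty by (force simp: supp_def)

end


section \<open>Conformal decomposition and fundamental circuits\<close>

text \<open>A ratio test: \<open>r\<close> is the least ratio \<open>u x / c x\<close> over the
  entries where the signs agree. No such entry changes sign and one becomes zero, while entries with
  opposite signs only grow in modulus.\<close>

lemma conformal_elimination:
  assumes fin: "finite (supp u)" and sub: "supp c \<subseteq> supp u" and x0: "0 < c x0 * u x0"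
  obtains r where "0 < r" "conformal (\<lambda>x. u x - r * c x) u" "supp (\<lambda>x. u x - r * c x) \<subset> supp u"
proof -
  define P where "P = {x. 0 < c x * u x}"
  define r where "r = Min ((\<lambda>x. u x / c x) ` P)"
  have "P \<subseteq> supp u" by (auto simp: P_def supp_def)
  then have finP: "finite P" using fin finite_subset by metis
  have "r \<in> (\<lambda>x. u x / c x) ` P"
    unfolding r_def using finP x0 by (intro Min_in) (auto simp: P_def)
  then obtain y where y: "y \<in> P" "r = u y / c y" by auto
  have le: "r \<le> u x / c x" if "x \<in> P" for x
    unfolding r_def using finP that by (intro Min_le) auto
  have r: "0 < r" using y by (auto simp: P_def zero_less_mult_iff zero_less_divide_iff)
  have nonneg: "0 < (u x - r * c x) * u x" if nz: "u x - r * c x \<noteq> 0" for x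
  proof (cases "x \<in> P")
    case True
    then have c: "c x \<noteq> 0" "0 < c x * u x" by (auto simp: P_def)
    then have eq: "(u x - r * c x) * u x = (c x * u x) * (u x / c x - r)"
      by (simp add: right_diff_distrib left_diff_distrib)
    moreover have "u x / c x \<noteq> r" using nz c by (auto simp: field_simps)
    then have "0 < u x / c x - r" using le[OF True] by simp
    ultimately show ?thesis using mult_pos_pos[OF c(2)] by metis
  next
    case False
    then have "c x * u x \<le> 0" by (auto simp: P_def)
    then have "r * (c x * u x) \<le> 0" using r by (simp add: mult_le_0_iff)
    moreover have "u x \<noteq> 0" using nz sub by (auto simp: supp_def)
    then have "0 < u x * u x" by (auto simp: zero_less_mult_iff)
    ultimately show ?thesis by (simp add: algebra_simps)
  qed
  show thesis
  proof (rule that[OF r])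
    show "conformal (\<lambda>x. u x - r * c x) u" using nonneg by (auto simp: conformal_def)
    have "u y - r * c y = 0" "u y \<noteq> 0" using y by (auto simp: P_def)
    then show "supp (\<lambda>x. u x - r * c x) \<subset> supp u" using sub by (auto simp: supp_def)
  qed
qed

lemma conformal_complementary:
  "conformal v u \<Longrightarrow> u x = 0 \<or> u (star x) = 0 \<Longrightarrow> v x = 0 \<or> v (star x) = 0"
  by (auto simp: conformal_def)

context regular_orthogonal_representation
begin

lemma lagrangian_supp: "u \<in> lagrangian \<Longrightarrow> supp u \<subseteq> E <+> E"
  using lagrangian_outside unfolding supp_def by (metis (mono_tags) mem_Collect_eq subsetI)

lemma finite_supp: "u \<in> lagrangian \<Longrightarrow> finite (supp u)"
  using finite_subset[OF lagrangian_supp finite_ground_sum] .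

lemma circuit_in_support:
  assumes u: "u \<in> lagrangian" and nz: "u \<noteq> (\<lambda>x. 0)" and compl: "\<And>x. u x = 0 \<or> u (star x) = 0"
  obtains C x where "C \<in> Cs" "supp C \<subseteq> supp u" "0 < C x * u x"
proof -
  obtain C where C: "C \<in> Cs" "supp C \<subseteq> supp u" using support_contains_circuit[OF assms] .
  obtain x where x: "C x \<noteq> 0" using circuit_nonzero[OF C(1)] by blast
  then have "u x \<noteq> 0" using C(2) by (auto simp: supp_def)
  with x have "0 < C x * u x \<or> 0 < (- C) x * u x" by (auto simp: zero_less_mult_iff mult_less_0_iff)
  then show thesis using that C uminus_circuit by (metis supp_uminus)
qed

text \<open>Induction on the size of the support. Subtracting a multiple of a circuit inside the
  support leaves a conformal vector of smaller support; if that is zero, \<open>u\<close> is a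
  positive multiple of the circuit, otherwise a circuit conformal to it is conformal to
  \<open>u\<close>.\<close>

lemma conformal_circuit_exists:
  assumes "u \<in> lagrangian" "u \<noteq> (\<lambda>x. 0)" "\<And>x. u x = 0 \<or> u (star x) = 0"
  shows "\<exists>C\<in>Cs. conformal C u"
  using assms
proof (induction "card (supp u)" arbitrary: u rule: less_induct)
  case less
  obtain C x where C: "C \<in> Cs" "supp C \<subseteq> supp u" "0 < C x * u x"
    using circuit_in_support[OF less.prems] .
  obtain r where r: "0 < r" "conformal (\<lambda>x. u x - r * C x) u" "supp (\<lambda>x. u x - r * C x) \<subset> supp u"
    using conformal_elimination[OF finite_supp[OF less.prems(1)] C(2,3)] .
  define v where "v = (\<lambda>x. u x - r * C x)"
  have v: "v \<in> lagrangian"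
    using lagrangian_lincomb[OF less.prems(1) circuit_in_lagrangian[OF C(1)], of 1 "- r"]
    by (simp add: v_def)
  show ?case
  proof (cases "v = (\<lambda>x. 0)")
    case True
    then have "u x = r * C x" for x by (metis v_def eq_iff_diff_eq_0)
    then have "C x * u x = r * (C x * C x)" for x by (metis mult.left_commute)
    moreover have "0 < C x * C x" if "C x \<noteq> 0" for x
      using that by (auto simp: zero_less_mult_iff)
    ultimately have "conformal C u" using r(1) unfolding conformal_def by (metis mult_pos_pos)
    then show ?thesis using C by blast
  next
    case False
    have "card (supp v) < card (supp u)"
      using r(3) finite_supp[OF less.prems(1)] by (simp add: psubset_card_mono v_def)
    moreover have "v x = 0 \<or> v (star x) = 0" for x
      using conformal_complementary[OF r(2) less.prems(3)] by (simp add: v_def)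
    ultimately obtain D where "D \<in> Cs" "conformal D v"
      using less.hyps[OF _ v False] by metis
    then show ?thesis using conformal_trans[OF _ r(2)] unfolding v_def by metis
  qed
qed

text \<open>A conformal circuit is subtracted until an entry of \<open>u\<close> vanishes. The
  remainder is conformal to \<open>u\<close> and is decomposed by induction.\<close>

lemma conformal_decomposition:
  assumes "u \<in> lagrangian" "\<And>x. u x = 0 \<or> u (star x) = 0"
  shows "\<exists>c. (\<forall>C\<in>Cs. 0 \<le> c C \<and> (c C \<noteq> 0 \<longrightarrow> conformal C u)) \<and> (\<forall>x. u x = (\<Sum>C\<in>Cs. c C * C x))"
  using assms
proof (induction "card (supp u)" arbitrary: u rule: less_induct)
  case less
  show ?case
  proof (cases "u = (\<lambda>x. 0)")
    case True
    then show ?thesis by (intro exI[of _ "\<lambda>C. 0"]) simp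
  next
    case False
    obtain C where C: "C \<in> Cs" "conformal C u"
      using conformal_circuit_exists[OF less.prems(1) False less.prems(2)] by blast
    have sub: "supp C \<subseteq> supp u" using C(2) by (auto simp: conformal_def supp_def)
    obtain x where "0 < C x * u x"
      using circuit_nonzero[OF C(1)] C(2) by (auto simp: conformal_def)
    then obtain r where r: "0 < r" "conformal (\<lambda>x. u x - r * C x) u"
      "supp (\<lambda>x. u x - r * C x) \<subset> supp u"
      using conformal_elimination[OF finite_supp[OF less.prems(1)] sub] by blast
    define v where "v = (\<lambda>x. u x - r * C x)"
    have v: "v \<in> lagrangian"
      using lagrangian_lincomb[OF less.prems(1) circuit_in_lagrangian[OF C(1)], of 1 "- r"]
      by (simp add: v_def)
    have "card (supp v) < card (supp u)"
      using r(3) finite_supp[OF less.prems(1)] by (simp add: psubset_card_mono v_def)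
    moreover have "v x = 0 \<or> v (star x) = 0" for x
      using conformal_complementary[OF r(2) less.prems(2)] by (simp add: v_def)
    ultimately obtain c where c: "\<forall>D\<in>Cs. 0 \<le> c D \<and> (c D \<noteq> 0 \<longrightarrow> conformal D v)"
      "\<forall>x. v x = (\<Sum>D\<in>Cs. c D * D x)"
      using less.hyps[OF _ v] by blast
    define d where "d D = c D + (if D = C then r else 0)" for D
    have "u x = (\<Sum>D\<in>Cs. d D * D x)" for x
    proof -
      have "(\<Sum>D\<in>Cs. d D * D x) = (\<Sum>D\<in>Cs. c D * D x) + (\<Sum>D\<in>Cs. if D = C then r * C x else 0)"
        unfolding sum.distrib[symmetric] by (intro sum.cong) (auto simp: d_def algebra_simps)
      also have "\<dots> = v x + r * C x" using c(2) C(1) finite_Cs by simp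
      finally show ?thesis by (simp add: v_def)
    qed
    moreover have "conformal D u" if "D \<in> Cs" "d D \<noteq> 0" for D
    proof (cases "D = C")
      case False
      then have "conformal D v" using that c by (auto simp: d_def)
      then show ?thesis using conformal_trans[OF _ r(2)] unfolding v_def by metis
    qed (simp add: C)
    ultimately show ?thesis using c r by (intro exI[of _ d]) (auto simp: d_def)
  qed
qed

lemma conformal_cover:
  assumes "u \<in> lagrangian" "\<And>x. u x = 0 \<or> u (star x) = 0" "u x \<noteq> 0"
  obtains C where "C \<in> Cs" "conformal C u" "C x \<noteq> 0"
proof -
  obtain c where c: "\<forall>C\<in>Cs. 0 \<le> c C \<and> (c C \<noteq> 0 \<longrightarrow> conformal C u)" "u x = (\<Sum>C\<in>Cs. c C * C x)"
    using conformal_decomposition[OF assms(1,2)] by blast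
  then obtain C where "C \<in> Cs" "c C * C x \<noteq> 0"
    using assms(3) by (auto elim: sum.not_neutral_contains_not_neutral)
  then show thesis using that c by auto
qed

text \<open>Tucker's theorem for the block of \<open>A\<close> indexed by \<open>D\<close>,
  conjugated by the signs \<open>s\<close> and scaled by \<open>t\<close>. With \<open>t = 1\<close>
  the two entries of a pair get the same prescribed sign, with \<open>t = - 1\<close> opposite
  ones.\<close>

lemma lagrangian_signs:
  assumes B: "B \<in> Bs" and D: "D \<subseteq> (E <+> E) - B"
    and s: "\<And>x. s x * s x = 1" and t: "t * t = 1"
  obtains u where "u \<in> lagrangian" "\<And>x. x \<in> (E <+> E) - B - D \<Longrightarrow> u x = 0"
    "\<And>x. x \<in> D \<Longrightarrow> 0 \<le> s x * u x" "\<And>x. x \<in> D \<Longrightarrow> 0 \<le> t * s x * u (star x)"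
    "\<And>x. x \<in> D \<Longrightarrow> 0 < s x * u x + t * s x * u (star x)"
proof -
  obtain F where F: "fundamental B F" using fundamental_exists[OF B] .
  have finD: "finite D" using D finite_ground_sum finite_subset by blast
  obtain X where X: "\<And>x. x \<in> D \<Longrightarrow> 0 \<le> X x"
    "\<And>x. x \<in> D \<Longrightarrow> 0 \<le> (\<Sum>y\<in>D. t * s x * s y * F y (star x) * X y)"
    "\<And>x. x \<in> D \<Longrightarrow> 0 < X x + (\<Sum>y\<in>D. t * s x * s y * F y (star x) * X y)"
  proof (rule tucker_skew[OF finD, of "\<lambda>x y. t * s x * s y * F y (star x)"])
    show "t * s x * s y * F y (star x) = - (t * s y * s x * F x (star y))" if "x \<in> D" "y \<in> D" for x y
    proof -
      have "F y (star x) = - F x (star y)"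
        using that D by (intro fundamental_skew[OF B F]) auto
      then show ?thesis by simp
    qed
  qed blast
  \<comment> \<open>The Lagrangian vector whose coordinates off \<open>B\<close> are
    \<open>s y * X y\<close> on \<open>D\<close> and zero elsewhere.\<close>
  define u where "u = (\<lambda>z. \<Sum>y\<in>D. (s y * X y) * F y z)"
  have u: "u \<in> lagrangian"
    unfolding u_def using finD D fundamental_in_Cs[OF F] circuit_in_lagrangian
    by (intro lagrangian_sum) auto
  have ux: "u x = (if x \<in> D then s x * X x else 0)" if x: "x \<in> (E <+> E) - B" for x
  proof -
    have "u x = (\<Sum>y\<in>D. if y = x then s x * X x else 0)"
      unfolding u_def
    proof (intro sum.cong refl)
      fix y assume "y \<in> D"
      then have "F y x = of_bool (x = y)" using D fundamental_delta[OF F _ x] by blast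
      then show "s y * X y * F y x = (if y = x then s x * X x else 0)" by simp
    qed
    then show ?thesis using finD by simp
  qed
  have sux: "s x * u x = X x" if "x \<in> D" for x
  proof -
    have "u x = s x * X x" using ux[of x] that D by auto
    then have "s x * u x = (s x * s x) * X x" by simp
    then show ?thesis by (simp only: s mult_1)
  qed
  have tsux: "t * s x * u (star x) = (\<Sum>y\<in>D. t * s x * s y * F y (star x) * X y)" for x
    unfolding u_def sum_distrib_left by (simp add: mult_ac)
  show thesis
    by (rule that[OF u]) (use ux sux tsux X in auto)
qed

section \<open>Uniqueness of fundamental circuits and the values of \<beta>\<close>

text \<open>The expansion of \<open>C\<close> over \<open>B\<close> has a single term, whose
  coefficient is the entry \<open>C x\<close>, that is 1 or -1.\<close>

lemma fundamental_unique:
  assumes B: "B \<in> Bs" and F: "fundamental B F" and x: "x \<in> (E <+> E) - B" and C: "C \<in> Cs"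
    and K: "supp C \<subseteq> sym_diff B {x, star x}"
  shows "C = F x \<or> C = - F x"
proof -
  note e = flip_circuit_entry[OF B x C K]
  have "C z = C x * F x z" for z
  proof -
    have "C z = (\<Sum>y\<in>(E <+> E) - B. if y = x then C x * F x z else 0)"
      unfolding lagrangian_expand[OF B F circuit_in_lagrangian[OF C], of z]
      using e(2) by (intro sum.cong) auto
    then show ?thesis using x finite_ground_sum by simp
  qed
  then have eq: "C = (\<lambda>z. C x * F x z)" by (rule ext)
  consider "C x = 1" | "C x = -1" using e(1) circuit_entry[OF C, of x] by auto
  then show ?thesis by cases (use eq in \<open>simp_all add: fun_Compl_def\<close>)
qed

lemma fundamental_supp:
  "fundamental B F \<Longrightarrow> x \<in> (E <+> E) - B \<Longrightarrow> supp (F x) \<subseteq> sym_diff B {x, star x}"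
  by (simp add: fundamental_def)

lemma FC_eq:
  assumes B: "B \<in> Bs" and F: "fundamental B F" and x: "x \<in> (E <+> E) - B"
  shows "FC E Bs B x = supp (F x)"
  unfolding FC_def
proof (rule the_equality)
  show "circuit E Bs (supp (F x)) \<and> supp (F x) \<subseteq> sym_diff B {x, star x}"
    using circuit_supp fundamental_in_Cs[OF F x] fundamental_supp[OF F x] by simp
next
  fix K assume K: "circuit E Bs K \<and> K \<subseteq> sym_diff B {x, star x}"
  then obtain C where C: "C \<in> Cs" "supp C = K" using circuit_vector by metis
  then have "C = F x \<or> C = - F x" using fundamental_unique[OF B F x] K by simp
  then show "K = supp (F x)" using C(2) by auto
qed

lemma signature_cases:
  "circuit_signature Cs \<sigma> \<Longrightarrow> C \<in> Cs \<Longrightarrow> C \<in> \<sigma> \<longleftrightarrow> - C \<notin> \<sigma>"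
  by (auto simp: circuit_signature_def)

text \<open>This resolves the definite descriptions in \<open>beta\<close>: since \<open>F x\<close>
  has entry 1 at \<open>x\<close>, the value only records which of \<open>F x\<close> and
  \<open>- F x\<close> the signature selects.\<close>

lemma beta_eq:
  assumes sig: "circuit_signature Cs \<sigma>" and B: "B \<in> Bs" and F: "fundamental B F"
    and e: "e \<in> E" and x: "x \<in> {Inl e, Inr e} - B"
  shows "beta E Bs \<sigma> B e = (if F x \<in> \<sigma> then 1/2 else - 1/2)"
proof -
  have xN: "x \<in> (E <+> E) - B" using e x by auto
  have star: "star x \<in> B" using basis_iff[OF B, of x] xN by auto
  have "(THE y. y \<in> {Inl e, Inr e} - B) = x"
    using x star by (intro the_equality) auto
  moreover have "(THE C. C \<in> \<sigma> \<and> supp C = supp (F x)) = (if F x \<in> \<sigma> then F x else - F x)"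
  proof (rule the_equality)
    show "(if F x \<in> \<sigma> then F x else - F x) \<in> \<sigma> \<and>
        supp (if F x \<in> \<sigma> then F x else - F x) = supp (F x)"
      using signature_cases[OF sig fundamental_in_Cs[OF F xN]] by auto
  next
    fix C assume C: "C \<in> \<sigma> \<and> supp C = supp (F x)"
    then have "C \<in> Cs" using sig by (auto simp: circuit_signature_def)
    then have "C = F x \<or> C = - F x"
      using fundamental_unique[OF B F xN] C fundamental_supp[OF F xN] by simp
    then show "C = (if F x \<in> \<sigma> then F x else - F x)"
      using C signature_cases[OF sig fundamental_in_Cs[OF F xN]] by auto
  qed
  ultimately show ?thesis
    using e fundamental_delta[OF F xN xN] by (simp add: beta_def FC_eq[OF B F xN] Let_def)
qed

end


section \<open>Circuit lattice and circuit reversals\<close>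

lemma proj_add: "proj (u + v) = proj u + proj v"
  and proj_diff: "proj (u - v) = proj u - proj v"
  and proj_uminus: "proj (- u) = - proj u"
  and proj_zero: "proj (\<lambda>x. 0) = 0"
  by (auto simp: proj_def fun_eq_iff)

lemma int_vecs_add: "v \<in> int_vecs E \<Longrightarrow> w \<in> int_vecs E \<Longrightarrow> v + w \<in> int_vecs E"
  and int_vecs_uminus: "v \<in> int_vecs E \<Longrightarrow> - v \<in> int_vecs E"
  and int_vecs_zero: "0 \<in> int_vecs E"
  by (auto simp: int_vecs_def rat_vecs_def)

lemma inv_int_vec_group: "v \<in> int_vecs E \<Longrightarrow> inv\<^bsub>int_vec_group E\<^esub> v = - v"
proof -
  assume v: "v \<in> int_vecs E"
  interpret comm_group "int_vec_group E" by (rule comm_group_int_vec_group)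
  show ?thesis
    using v int_vecs_uminus[OF v] by (intro inv_equality) (auto simp: int_vec_group_def)
qed

text \<open>The coset of \<open>int_vecs E\<close> that contains the orientations.\<close>

definition half_vecs :: "'a set \<Rightarrow> ('a \<Rightarrow> rat) set" where
  "half_vecs E = {y \<in> rat_vecs E. \<forall>e\<in>E. y e - 1/2 \<in> \<int>}"

lemma orientation_half: "O1 \<in> orientations E \<Longrightarrow> O1 \<in> half_vecs E"
proof -
  assume O1: "O1 \<in> orientations E"
  have "O1 e - 1/2 \<in> {0, -1}" if "e \<in> E" for e
    using O1 that by (auto simp: orientations_def)
  then have "O1 e - 1/2 \<in> \<int>" if "e \<in> E" for e
    using that by (metis Ints_0 Ints_1 Ints_minus insert_iff singletonD)
  then show ?thesis using O1 by (simp add: orientations_def half_vecs_def)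
qed

lemma half_vecs_shift: "v \<in> int_vecs E \<Longrightarrow> y \<in> half_vecs E \<Longrightarrow> v + y \<in> half_vecs E"
  unfolding half_vecs_def int_vecs_def rat_vecs_def
  by (auto simp: add_diff_eq[symmetric] intro!: Ints_add)

lemma half_vecs_diff: "y \<in> half_vecs E \<Longrightarrow> z \<in> half_vecs E \<Longrightarrow> y - z \<in> int_vecs E"
proof -
  assume "y \<in> half_vecs E" "z \<in> half_vecs E"
  moreover have "y e - z e \<in> \<int>" if "y e - 1/2 \<in> \<int>" "z e - 1/2 \<in> \<int>" for e
    using Ints_diff[OF that] by simp
  ultimately show ?thesis
    unfolding half_vecs_def int_vecs_def rat_vecs_def by simp
qed

lemma half_abs_ge:
  assumes "(y::rat) - 1/2 \<in> \<int>"
  shows "1/2 \<le> \<bar>y\<bar>"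
proof -
  obtain k where k: "y - 1/2 = of_int k" using assms by (elim Ints_cases)
  show ?thesis
  proof (cases "0 \<le> k")
    case True
    then have "0 \<le> (of_int k :: rat)" by simp
    then show ?thesis using k by linarith
  next
    case False
    then have "(of_int k :: rat) \<le> of_int (-1)" by (subst of_int_le_iff) simp
    then show ?thesis using k by simp
  qed
qed

text \<open>A \<open>group_action\<close> is a homomorphism into \<open>BijGroup X\<close>. The
  inverse of \<open>g\<close> supplies the inverse map, and extensionality is what turns pointwise
  equations into equations in that group.\<close>

lemma simply_transitive_actionI:
  assumes G: "group G" and X: "X \<noteq> {}"
    and ext: "\<And>g. g \<in> carrier G \<Longrightarrow> \<phi> g \<in> extensional X"
    and closed: "\<And>g x. g \<in> carrier G \<Longrightarrow> x \<in> X \<Longrightarrow> \<phi> g x \<in> X"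
    and one: "\<And>x. x \<in> X \<Longrightarrow> \<phi> \<one>\<^bsub>G\<^esub> x = x"
    and mult: "\<And>g h x. g \<in> carrier G \<Longrightarrow> h \<in> carrier G \<Longrightarrow> x \<in> X \<Longrightarrow>
      \<phi> (g \<otimes>\<^bsub>G\<^esub> h) x = \<phi> g (\<phi> h x)"
    and simple: "\<And>x y. x \<in> X \<Longrightarrow> y \<in> X \<Longrightarrow> \<exists>!g. g \<in> carrier G \<and> \<phi> g x = y"
  shows "simply_transitive_action G X \<phi>"
proof -
  interpret G: group G by fact
  have bij: "\<phi> g \<in> carrier (BijGroup X)" if g: "g \<in> carrier G" for g
  proof -
    have "bij_betw (\<phi> g) X X"
    proof (rule bij_betw_byWitness[where f' = "\<phi> (inv\<^bsub>G\<^esub> g)"])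
      show "\<forall>x\<in>X. \<phi> (inv\<^bsub>G\<^esub> g) (\<phi> g x) = x"
        using g by (simp add: mult[symmetric] one)
      show "\<forall>x\<in>X. \<phi> g (\<phi> (inv\<^bsub>G\<^esub> g) x) = x"
        using g by (simp add: mult[symmetric] one)
    qed (use g closed in auto)
    then show ?thesis using ext[OF g] by (simp add: BijGroup_def Bij_def)
  qed
  have "\<phi> (g \<otimes>\<^bsub>G\<^esub> h) = \<phi> g \<otimes>\<^bsub>BijGroup X\<^esub> \<phi> h" if "g \<in> carrier G" "h \<in> carrier G" for g h
  proof -
    have "\<phi> g \<otimes>\<^bsub>BijGroup X\<^esub> \<phi> h = compose X (\<phi> g) (\<phi> h)"
      using bij that by (simp add: BijGroup_def)
    also have "\<dots> = \<phi> (g \<otimes>\<^bsub>G\<^esub> h)"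
      using that ext[of "g \<otimes>\<^bsub>G\<^esub> h"] mult
      by (intro extensionalityI[of _ X]) (auto simp: compose_def)
    finally show ?thesis by simp
  qed
  then have "group_hom G (BijGroup X) \<phi>"
    using bij by (intro group_hom.intro group_hom_axioms.intro group_BijGroup G homI) auto
  then show ?thesis
    using X simple by (simp add: simply_transitive_action_def group_action_def)
qed

lemma orientations_mix:
  assumes "O1 \<in> orientations E" "O2 \<in> orientations E" "\<And>e. w e = O1 e \<or> w e = O2 e"
  shows "w \<in> orientations E"
  unfolding orientations_def rat_vecs_def
proof (intro CollectI conjI allI ballI impI)
  show "w e = 0" if "e \<notin> E" for e
    using assms(1,2) assms(3)[of e] that by (auto simp: orientations_def rat_vecs_def)
  show "w e = 1/2 \<or> w e = -1/2" if "e \<in> E" for e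
    using assms(1,2) assms(3)[of e] that by (auto simp: orientations_def)
qed

context regular_orthogonal_representation
begin

section \<open>The circuit lattice and the Jacobian\<close>

lemma proj_circuit_int: "proj ` Cs \<subseteq> int_vecs E"
proof
  fix w assume "w \<in> proj ` Cs"
  then obtain C where C: "C \<in> Cs" "w = proj C" by auto
  have "C x \<in> \<int>" for x using circuit_entry[OF C(1), of x] by auto
  then show "w \<in> int_vecs E"
    using circuit_outside[OF C(1)] C(2) by (auto simp: int_vecs_def rat_vecs_def proj_def)
qed

lemma subgroup_lattice: "subgroup (circuit_lattice E Cs) (int_vec_group E)"
proof -
  interpret comm_group "int_vec_group E" by (rule comm_group_int_vec_group)
  show ?thesis
    unfolding circuit_lattice_def using proj_circuit_int
    by (intro generate_is_subgroup) (simp add: int_vec_group_def)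
qed

lemma lattice_int: "w \<in> circuit_lattice E Cs \<Longrightarrow> w \<in> int_vecs E"
  using subgroup.subset[OF subgroup_lattice] by (auto simp: int_vec_group_def)

lemma lattice_zero: "0 \<in> circuit_lattice E Cs"
  using subgroup.one_closed[OF subgroup_lattice] by (simp add: int_vec_group_def)

lemma lattice_add:
  "v \<in> circuit_lattice E Cs \<Longrightarrow> w \<in> circuit_lattice E Cs \<Longrightarrow> v + w \<in> circuit_lattice E Cs"
  using subgroup.m_closed[OF subgroup_lattice] by (simp add: int_vec_group_def)

lemma lattice_uminus: "v \<in> circuit_lattice E Cs \<Longrightarrow> - v \<in> circuit_lattice E Cs"
  using subgroup.m_inv_closed[OF subgroup_lattice] lattice_int inv_int_vec_group by metis

lemma lattice_proj: "C \<in> Cs \<Longrightarrow> proj C \<in> circuit_lattice E Cs"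
  unfolding circuit_lattice_def by (intro generate.incl) simp

text \<open>Isotropy concerns the two entries of a pair and is invisible after projection, so
  lattice elements are lifted to integral Lagrangian vectors, generator by generator.\<close>

lemma lattice_lift:
  assumes "w \<in> circuit_lattice E Cs"
  obtains u where "u \<in> lagrangian" "\<And>x. u x \<in> \<int>" "w = proj u"
proof -
  have C: "C \<in> lagrangian \<and> (\<forall>x. C x \<in> \<int>)" if "C \<in> Cs" for C
    using circuit_in_lagrangian[OF that] circuit_entry[OF that] by (metis Ints_0 Ints_1 Ints_minus)
  have "\<exists>u. u \<in> lagrangian \<and> (\<forall>x. u x \<in> \<int>) \<and> w = proj u"
    using assms unfolding circuit_lattice_def
  proof (induction rule: generate.induct)
    case one
    show ?case
      using lagrangian_zero by (intro exI[of _ "\<lambda>x. 0"]) (simp add: int_vec_group_def proj_zero)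
  next
    case (incl h)
    then show ?case using C by auto
  next
    case (inv h)
    then obtain D where D: "D \<in> Cs" "h = proj D" by auto
    then have "inv\<^bsub>int_vec_group E\<^esub> h = proj (- D)"
      using inv_int_vec_group proj_circuit_int proj_uminus by (metis imageI subsetD)
    then show ?case using C[OF uminus_circuit[OF D(1)]] by auto
  next
    case (eng h1 h2)
    then obtain u v where "u \<in> lagrangian" "\<forall>x. u x \<in> \<int>" "h1 = proj u"
      "v \<in> lagrangian" "\<forall>x. v x \<in> \<int>" "h2 = proj v" by auto
    note uv = this
    have "h1 \<otimes>\<^bsub>int_vec_group E\<^esub> h2 = proj (u + v)"
      unfolding proj_add by (simp add: int_vec_group_def uv)
    moreover have "\<forall>x. (u + v) x \<in> \<int>" using uv by simp
    ultimately show ?case using lagrangian_add[of u v] uv by blast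
  qed
  then show thesis using that by auto
qed

lemma J_refl: "J_equiv E Cs v v"
  by (simp add: J_equiv_def lattice_zero)

lemma J_sym: "J_equiv E Cs v w \<Longrightarrow> J_equiv E Cs w v"
  using lattice_uminus[of "w - v"] by (simp add: J_equiv_def)

lemma J_trans: "J_equiv E Cs u v \<Longrightarrow> J_equiv E Cs v w \<Longrightarrow> J_equiv E Cs u w"
  using lattice_add[of "v - u" "w - v"] by (simp add: J_equiv_def)

lemma J_add_left: "J_equiv E Cs (u + v) (u + w) \<longleftrightarrow> J_equiv E Cs v w"
  by (simp add: J_equiv_def)

lemma J_add_right: "J_equiv E Cs (v + u) (w + u) \<longleftrightarrow> J_equiv E Cs v w"
  by (simp add: J_equiv_def)

lemma J_class_eq_iff: "J_class E Cs v = J_class E Cs w \<longleftrightarrow> J_equiv E Cs v w"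
proof
  assume "J_class E Cs v = J_class E Cs w"
  then show "J_equiv E Cs v w" using J_refl[of w] unfolding J_class_def by blast
next
  assume "J_equiv E Cs v w"
  then show "J_class E Cs v = J_class E Cs w"
    using J_trans J_sym unfolding J_class_def by (metis (no_types, lifting) Collect_cong)
qed

lemma group_Jac: "group (Jac E Cs)"
  using comm_group_Jac[OF proj_circuit_int] by (simp add: comm_group_def)

lemma Jac_one: "\<one>\<^bsub>Jac E Cs\<^esub> = J_class E Cs 0"
proof -
  interpret comm_group "int_vec_group E" by (rule comm_group_int_vec_group)
  have "circuit_lattice E Cs #>\<^bsub>int_vec_group E\<^esub> 0 = circuit_lattice E Cs"
    by (auto simp: r_coset_def int_vec_group_def)
  then show ?thesis by (simp add: Jac_def FactGroup_def J_class_eq_coset)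
qed

lemma Jac_mult:
  assumes "v \<in> int_vecs E" "w \<in> int_vecs E"
  shows "J_class E Cs v \<otimes>\<^bsub>Jac E Cs\<^esub> J_class E Cs w = J_class E Cs (v + w)"
proof -
  interpret comm_group "int_vec_group E" by (rule comm_group_int_vec_group)
  have "normal (circuit_lattice E Cs) (int_vec_group E)"
    using subgroup_lattice by (rule subgroup_imp_normal)
  from normal.rcos_sum[OF this, of v w] show ?thesis
    using assms by (simp add: Jac_def FactGroup_def J_class_eq_coset int_vec_group_def)
qed

section \<open>Circuit reversals and J-equivalence\<close>

lemma circuit_reversal_J: "(v, w) \<in> circuit_reversal E Cs \<Longrightarrow> J_equiv E Cs v w"
  using lattice_proj by (auto simp: circuit_reversal_def J_equiv_def)

lemma reversals_J: "(v, w) \<in> (circuit_reversal E Cs)\<^sup>* \<Longrightarrow> J_equiv E Cs v w"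
  by (induction rule: rtrancl_induct) (auto intro: J_refl J_trans circuit_reversal_J)

text \<open>Conformal circuits are removed from \<open>u\<close> one at a time. As all entries are
  0, 1 or -1, such a circuit coincides with \<open>u\<close> on its support, so each intermediate
  vector takes every coordinate from one of the two given orientations.\<close>

lemma reversals_conformal:
  assumes "u \<in> lagrangian" "\<And>x. u x = 0 \<or> u x = 1 \<or> u x = -1" "\<And>x. u x = 0 \<or> u (star x) = 0"
    and "O1 \<in> orientations E" "O1 + proj u \<in> orientations E"
  shows "(O1, O1 + proj u) \<in> (circuit_reversal E Cs)\<^sup>*"
  using assms
proof (induction "card (supp u)" arbitrary: u O1 rule: less_induct)
  case less
  show ?case
  proof (cases "u = (\<lambda>x. 0)")
    case True
    then show ?thesis by (simp add: proj_zero)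
  next
    case False
    obtain C where C: "C \<in> Cs" "conformal C u"
      using conformal_circuit_exists[OF less.prems(1) False less.prems(3)] by blast
    have Cu: "C x = 0 \<or> C x = u x" for x
      using circuit_entry[OF C(1), of x] less.prems(2)[of x] C(2) unfolding conformal_def
      by force
    define v where "v = u - C"
    have v: "v \<in> lagrangian"
      unfolding v_def by (rule lagrangian_diff[OF less.prems(1) circuit_in_lagrangian[OF C(1)]])
    have vx: "v x = 0 \<or> v x = u x" for x using Cu[of x] by (auto simp: v_def)
    obtain x where x: "C x \<noteq> 0" using circuit_nonzero[OF C(1)] by blast
    have "supp v \<subset> supp u"
    proof
      show "supp v \<subseteq> supp u" using vx unfolding supp_def by (metis (mono_tags) mem_Collect_eq subsetI)
      have "x \<in> supp u" "x \<notin> supp v" using x Cu[of x] by (auto simp: supp_def v_def)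
      then show "supp v \<noteq> supp u" by auto
    qed
    then have card: "card (supp v) < card (supp u)"
      using finite_supp[OF less.prems(1)] by (rule psubset_card_mono[rotated])
    have pC: "proj C e = 0 \<or> proj C e = proj u e" for e
      using Cu[of "Inl e"] Cu[of "Inr e"] less.prems(3)[of "Inl e"] unfolding proj_def by auto
    have "O1 + proj C \<in> orientations E"
    proof (rule orientations_mix[OF less.prems(4,5)])
      show "(O1 + proj C) e = O1 e \<or> (O1 + proj C) e = (O1 + proj u) e" for e
        using pC[of e] by auto
    qed
    moreover have eq: "O1 + proj C + proj v = O1 + proj u"
      by (simp add: v_def proj_diff algebra_simps)
    moreover have "v x = 0 \<or> v x = 1 \<or> v x = -1" "v x = 0 \<or> v (star x) = 0" for x
      using vx[of x] vx[of "star x"] less.prems(2)[of x] less.prems(3)[of x] by auto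
    ultimately have "(O1 + proj C, O1 + proj u) \<in> (circuit_reversal E Cs)\<^sup>*"
      using less.hyps[OF card v, of "O1 + proj C"] less.prems(5) unfolding eq by blast
    moreover have "(O1, O1 + proj C) \<in> circuit_reversal E Cs"
      using \<open>O1 + proj C \<in> orientations E\<close> less.prems(4) C(1) by (auto simp: circuit_reversal_def)
    ultimately show ?thesis by (rule converse_rtrancl_into_rtrancl[rotated])
  qed
qed

text \<open>The isotropy \<open>\<Sum>e. u e * u e\<^sup>* = 0\<close> leaves no room for cancellation inside a pair \<open>e, e\<^sup>*\<close>.\<close>

lemma orientation_diff_lift:
  assumes O: "O1 \<in> orientations E" "O2 \<in> orientations E" and u: "u \<in> lagrangian"
    and int: "\<And>x. u x \<in> \<int>" and eq: "O2 = O1 + proj u"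
  shows "u x = 0 \<or> u (star x) = 0" "u x = 0 \<or> u x = 1 \<or> u x = -1"
proof -
  have p: "proj u e = 0 \<or> proj u e = 1 \<or> proj u e = -1" for e
  proof (cases "e \<in> E")
    case True
    then have "O1 e = 1/2 \<or> O1 e = -1/2" "O2 e = 1/2 \<or> O2 e = -1/2"
      using O by (auto simp: orientations_def)
    moreover have "proj u e = O2 e - O1 e" by (simp add: eq)
    ultimately show ?thesis by auto
  next
    case False
    then show ?thesis using lagrangian_outside[OF u] by (simp add: proj_def)
  qed
  have le: "u (Inl e) * u (Inr e) \<le> 0" for e
  proof (rule ccontr)
    obtain a where a: "u (Inl e) = of_int a" using int[of "Inl e"] by (rule Ints_cases)
    obtain b where b: "u (Inr e) = of_int b" using int[of "Inr e"] by (rule Ints_cases)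
    note ab = a b
    assume "\<not> u (Inl e) * u (Inr e) \<le> 0"
    then have "(0::rat) < of_int (a * b)" by (simp add: ab not_le)
    then have "0 < a * b" by (simp only: of_int_0_less_iff)
    \<comment> \<open>Nonzero integers of equal sign have a sum of modulus at least 2, whereas two
      orientations differ by at most 1 in each coordinate.\<close>
    then have "2 \<le> a + b \<or> a + b \<le> -2" by (auto simp: zero_less_mult_iff)
    moreover have "of_int (a + b) = (0::rat) \<or> of_int (a + b) = (1::rat) \<or> of_int (a + b) = (-1::rat)"
      using p[of e] by (simp add: proj_def ab)
    then have "a + b = 0 \<or> a + b = 1 \<or> a + b = -1" by linarith
    ultimately show False by auto
  qed
  then show c: "u x = 0 \<or> u (star x) = 0" for x using isotropic_complementary[OF u] by blast
  show "u x = 0 \<or> u x = 1 \<or> u x = -1"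
    using c[of x] p[of "base x"] by (cases x) (auto simp: proj_def)
qed

lemma reversals_iff_J:
  assumes "O1 \<in> orientations E" "O2 \<in> orientations E"
  shows "(O1, O2) \<in> (circuit_reversal E Cs)\<^sup>* \<longleftrightarrow> J_equiv E Cs O1 O2"
proof
  assume "J_equiv E Cs O1 O2"
  then obtain u where u: "u \<in> lagrangian" "\<And>x. u x \<in> \<int>" "O2 - O1 = proj u"
    unfolding J_equiv_def by (rule lattice_lift) blast
  then have eq: "O2 = O1 + proj u" by (metis add_diff_cancel_left' add.commute diff_add_cancel)
  show "(O1, O2) \<in> (circuit_reversal E Cs)\<^sup>*"
    using reversals_conformal[OF u(1) orientation_diff_lift(2,1)[OF assms u(1,2) eq]] assms
    by (simp add: eq)
qed (rule reversals_J)

lemma R_class_eq_iff: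
  assumes "O1 \<in> orientations E" "O2 \<in> orientations E"
  shows "R_class E Cs O1 = R_class E Cs O2 \<longleftrightarrow> J_equiv E Cs O1 O2"
proof
  assume "R_class E Cs O1 = R_class E Cs O2"
  then have "(O1, O2) \<in> (circuit_reversal E Cs)\<^sup>*" unfolding R_class_def by blast
  then show "J_equiv E Cs O1 O2" by (rule reversals_J)
next
  assume "J_equiv E Cs O1 O2"
  then have "(O1, O2) \<in> (circuit_reversal E Cs)\<^sup>*" "(O2, O1) \<in> (circuit_reversal E Cs)\<^sup>*"
    using reversals_iff_J assms J_sym by auto
  then show "R_class E Cs O1 = R_class E Cs O2"
    unfolding R_class_def by (auto intro: rtrancl_trans)
qed

section \<open>Moving half-integral vectors to orientations\<close>

text \<open>The circuit is conformal to the signs of \<open>y\<close> and meets \<open>e0\<close>. No entry grows in modulus, because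
  all of them are at least \<open>1/2\<close> in modulus.\<close>

lemma half_vec_reduce:
  assumes y: "y \<in> half_vecs E" and e0: "e0 \<in> E" "1 \<le> \<bar>y e0\<bar>"
  obtains C where "C \<in> Cs" "(\<Sum>e\<in>E. \<bar>(y - proj C) e\<bar>) \<le> (\<Sum>e\<in>E. \<bar>y e\<bar>) - 1"
proof -
  define s where "s x = (if y (base x) < 0 then -1 else 1 :: rat)" for x
  have s_star: "s (star x) = s x" for x by (simp add: s_def)
  obtain B where B: "B \<in> Bs" using obtain_basis .
  \<comment> \<open>With \<open>t = 1\<close> and no excluded coordinates, both entries of every
    pair have the sign of \<open>y\<close> there and at least one of them is nonzero.\<close>
  obtain u where u: "u \<in> lagrangian"
    "\<And>x. x \<in> (E <+> E) - B \<Longrightarrow> 0 \<le> s x * u x" "\<And>x. x \<in> (E <+> E) - B \<Longrightarrow> 0 \<le> s x * u (star x)"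
    "\<And>x. x \<in> (E <+> E) - B \<Longrightarrow> 0 < s x * u x + s x * u (star x)"
  proof (rule lagrangian_signs[OF B subset_refl, of s 1])
    show "s x * s x = 1" for x by (simp add: s_def)
  qed (simp_all only: mult_1)
  have su: "0 \<le> s x * u x" "0 < s x * (u x + u (star x))" if "x \<in> E <+> E" for x
    using that u(2-4)[of x] u(2-4)[of "star x"] basis_iff[OF B that]
    by (cases "x \<in> B"; simp add: s_star distrib_left add.commute)+
  have "0 \<le> u (Inl e) * u (Inr e)" if "e \<in> E" for e
    using su(1)[of "Inl e"] su(1)[of "Inr e"] that
    by (auto simp: s_def mult_le_0_iff zero_le_mult_iff split: if_splits)
  note compl = isotropic_complementary'[OF u(1) this]
  have "u (Inl e0) \<noteq> 0 \<or> u (Inr e0) \<noteq> 0" using su(2)[of "Inl e0"] e0 by auto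
  then obtain x where x: "x \<in> {Inl e0, Inr e0}" "u x \<noteq> 0" by auto
  obtain C where C: "C \<in> Cs" "conformal C u" "C x \<noteq> 0"
    using conformal_cover[OF u(1) compl x(2)] .
  have Cc: "C z = 0 \<or> C (star z) = 0" for z
    using conformal_complementary[OF C(2) compl] .
  have Cs: "C z = 0 \<or> C z = s z" for z
  proof (cases "C z = 0")
    case False
    then have "0 < C z * u z" using C(2) by (auto simp: conformal_def)
    moreover have "z \<in> E <+> E" using False circuit_outside[OF C(1)] by blast
    ultimately show ?thesis
      using su(1)[of z] circuit_entry[OF C(1), of z] by (auto simp: s_def split: if_splits)
  qed simp
  have pC: "proj C e = 0 \<or> proj C e = s (Inl e)" for e
    using Cs[of "Inl e"] Cs[of "Inr e"] Cc[of "Inl e"] by (auto simp: proj_def s_def)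
  have le: "\<bar>(y - proj C) e\<bar> \<le> \<bar>y e\<bar>" if "e \<in> E" for e
    using pC[of e] half_abs_ge[of "y e"] y that
    by (auto simp: half_vecs_def s_def abs_if split: if_splits)
  have "proj C e0 = s (Inl e0)"
    using x(1) C(3) Cs[of "Inl e0"] Cs[of "Inr e0"] Cc[of "Inl e0"]
    by (auto simp: proj_def s_def)
  \<comment> \<open>Since \<open>y e0\<close> has modulus at least 1, the unit step towards zero
    does not pass zero and the full unit is gained.\<close>
  then have "\<bar>(y - proj C) e0\<bar> = \<bar>y e0\<bar> - 1"
    using e0 by (auto simp: s_def abs_if split: if_splits)
  moreover have "(\<Sum>e\<in>E - {e0}. \<bar>(y - proj C) e\<bar>) \<le> (\<Sum>e\<in>E - {e0}. \<bar>y e\<bar>)"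
    using le by (intro sum_mono) auto
  ultimately show thesis
    using that[OF C(1)] e0 finite_ground by (simp add: sum.remove[of E e0])
qed

text \<open>Induction on an integer bound for the sum of the moduli. A half-integral vector that is
  not an orientation has an entry of modulus at least 1, and reducing it lowers the sum by at least
  1.\<close>

lemma half_vec_J_orientation:
  assumes "y \<in> half_vecs E"
  obtains O1 where "O1 \<in> orientations E" "J_equiv E Cs y O1"
proof -
  have "\<exists>O1\<in>orientations E. J_equiv E Cs y O1"
    if "y \<in> half_vecs E" "(\<Sum>e\<in>E. \<bar>y e\<bar>) \<le> of_nat n" for n y
    using that
  proof (induction n arbitrary: y)
    case 0
    \<comment> \<open>Each coordinate contributes at least 1/2, so the bound 0 forces
      \<open>E\<close> to be empty.\<close>
    have "1/2 \<le> (\<Sum>e\<in>E. \<bar>y e\<bar>)" if "e \<in> E" for e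
    proof -
      have "1/2 \<le> \<bar>y e\<bar>" using 0 that by (intro half_abs_ge) (auto simp: half_vecs_def)
      also have "\<dots> \<le> (\<Sum>e\<in>E. \<bar>y e\<bar>)" using that finite_ground by (intro member_le_sum) auto
      finally show ?thesis .
    qed
    then have "E = {}" using 0 by force
    then have "y \<in> orientations E" using 0 by (simp add: half_vecs_def orientations_def)
    then show ?case using J_refl by blast
  next
    case (Suc n)
    show ?case
    proof (cases "y \<in> orientations E")
      case False
      then obtain e0 where e0: "e0 \<in> E" "y e0 \<noteq> 1/2" "y e0 \<noteq> -1/2"
        using Suc.prems by (auto simp: orientations_def half_vecs_def)
      obtain k where k: "y e0 - 1/2 = of_int k"
        using Suc.prems e0 by (auto simp: half_vecs_def elim: Ints_cases)
      have "k \<noteq> 0" "k \<noteq> -1" using k e0 by auto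
      then have "1 \<le> k \<or> k \<le> -2" by linarith
      then have "(1::rat) \<le> of_int k \<or> of_int k \<le> (-2::rat)"
        by (metis of_int_1_le_iff of_int_le_iff of_int_minus of_int_numeral)
      then have "1 \<le> \<bar>y e0\<bar>" using k by linarith
      then obtain C where C: "C \<in> Cs" "(\<Sum>e\<in>E. \<bar>(y - proj C) e\<bar>) \<le> (\<Sum>e\<in>E. \<bar>y e\<bar>) - 1"
        using half_vec_reduce[OF Suc.prems(1) e0(1)] by blast
      have "- proj C \<in> int_vecs E" using C(1) proj_circuit_int int_vecs_uminus by blast
      then have "y - proj C \<in> half_vecs E"
        using half_vecs_shift[OF _ Suc.prems(1)] by (metis add.commute add_uminus_conv_diff)
      moreover have "(\<Sum>e\<in>E. \<bar>(y - proj C) e\<bar>) \<le> of_nat n" using C(2) Suc.prems(2) by simp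
      ultimately obtain O1 where O1: "O1 \<in> orientations E" "J_equiv E Cs (y - proj C) O1"
        using Suc.IH by blast
      have "J_equiv E Cs (y - proj C) y" using lattice_proj[OF C(1)] by (simp add: J_equiv_def)
      then show ?thesis using O1 J_sym J_trans by blast
    qed (use J_refl in blast)
  qed
  moreover obtain n where "(\<Sum>e\<in>E. \<bar>y e\<bar>) \<le> of_nat n" using real_arch_simple by blast
  ultimately show thesis using assms that by blast
qed

end


section \<open>The action of the Jacobian on reversal classes\<close>

lemma finite_orientations: "finite E \<Longrightarrow> finite (orientations E)"
proof (rule finite_subset)
  show "orientations E \<subseteq> {f. \<forall>e. (e \<in> E \<longrightarrow> f e \<in> {1/2, -1/2}) \<and> (e \<notin> E \<longrightarrow> f e = 0)}"
    by (auto simp: orientations_def rat_vecs_def)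
  show "finite {f. \<forall>e. (e \<in> E \<longrightarrow> f e \<in> {1/2, -1/2}) \<and> (e \<notin> E \<longrightarrow> f e = (0::rat))}"
    if "finite E" by (rule finite_set_of_finite_funs[OF that]) simp
qed

lemma orientations_nonempty: "orientations E \<noteq> {}"
proof -
  have "(\<lambda>e. if e \<in> E then 1/2 else 0) \<in> orientations E"
    by (simp add: orientations_def rat_vecs_def)
  then show ?thesis by blast
qed

context regular_orthogonal_representation
begin

text \<open>A common frame for both actions: \<open>r\<close> embeds \<open>X\<close> into the
  half-integral vectors modulo J-equivalence, and \<open>act\<close> says that \<phi> becomes
  translation there. The group element taking \<open>x\<close> to \<open>y\<close> is the class of
  \<open>r y - r x\<close>. For reversal classes \<open>r\<close> chooses an orientation, for bases
  it is \<open>beta\<close>.\<close>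

lemma representative_action:
  assumes X: "X \<noteq> {}" and half: "\<And>x. x \<in> X \<Longrightarrow> r x \<in> half_vecs E"
    and inj: "\<And>x y. x \<in> X \<Longrightarrow> y \<in> X \<Longrightarrow> J_equiv E Cs (r x) (r y) \<Longrightarrow> x = y"
    and ext: "\<And>g. \<phi> g \<in> extensional X"
    and closed: "\<And>v x. v \<in> int_vecs E \<Longrightarrow> x \<in> X \<Longrightarrow> \<phi> (J_class E Cs v) x \<in> X"
    and act: "\<And>v x. v \<in> int_vecs E \<Longrightarrow> x \<in> X \<Longrightarrow> J_equiv E Cs (v + r x) (r (\<phi> (J_class E Cs v) x))"
  shows "simply_transitive_action (Jac E Cs) X \<phi>"
proof -
  have eqI: "\<phi> (J_class E Cs v) x = y"
    if "v \<in> int_vecs E" "x \<in> X" "y \<in> X" "J_equiv E Cs (v + r x) (r y)" for v x y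
    using inj[OF closed[OF that(1,2)] that(3)] J_trans[OF J_sym[OF act[OF that(1,2)]] that(4)] .
  show ?thesis
  proof (rule simply_transitive_actionI[OF group_Jac X ext])
    show "\<phi> g x \<in> X" if "g \<in> carrier (Jac E Cs)" "x \<in> X" for g x
      using that closed by (auto simp: carrier_Jac)
    show "\<phi> \<one>\<^bsub>Jac E Cs\<^esub> x = x" if "x \<in> X" for x
      using eqI[OF int_vecs_zero that that] J_refl by (simp add: Jac_one)
    show "\<phi> (g \<otimes>\<^bsub>Jac E Cs\<^esub> h) x = \<phi> g (\<phi> h x)"
      if gh: "g \<in> carrier (Jac E Cs)" "h \<in> carrier (Jac E Cs)" and x: "x \<in> X" for g h x
    proof -
      obtain v w where v: "v \<in> int_vecs E" "g = J_class E Cs v"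
        and w: "w \<in> int_vecs E" "h = J_class E Cs w" using gh by (auto simp: carrier_Jac)
      have hx: "\<phi> h x \<in> X" using closed[OF w(1) x] w by simp
      have "J_equiv E Cs (v + (w + r x)) (v + r (\<phi> h x))"
        unfolding J_add_left w(2) by (rule act[OF w(1) x])
      then have "J_equiv E Cs (v + w + r x) (r (\<phi> g (\<phi> h x)))"
        using J_trans act[OF v(1) hx] by (simp add: add.assoc v(2))
      then show ?thesis
        using eqI[OF int_vecs_add[OF v(1) w(1)] x] closed[OF v(1) hx]
        by (simp add: v(2) w(2) Jac_mult[OF v(1) w(1)])
    qed
    show "\<exists>!g. g \<in> carrier (Jac E Cs) \<and> \<phi> g x = y" if x: "x \<in> X" and y: "y \<in> X" for x y
    proof (rule ex1I[of _ "J_class E Cs (r y - r x)"])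
      have d: "r y - r x \<in> int_vecs E" using half_vecs_diff half x y by blast
      then show "J_class E Cs (r y - r x) \<in> carrier (Jac E Cs) \<and> \<phi> (J_class E Cs (r y - r x)) x = y"
        using eqI[OF d x y] J_refl by (simp add: carrier_Jac)
      fix g assume g: "g \<in> carrier (Jac E Cs) \<and> \<phi> g x = y"
      then obtain v where v: "v \<in> int_vecs E" "g = J_class E Cs v" by (auto simp: carrier_Jac)
      have "J_equiv E Cs (v + r x) (r y - r x + r x)" using act[OF v(1) x] g v by simp
      then show "g = J_class E Cs (r y - r x)"
        unfolding J_add_right v(2) J_class_eq_iff .
    qed
  qed
qed

section \<open>The action on reversal classes\<close>

lemma jac_action_well_defined:
  assumes "O1 \<in> orientations E" "O1' \<in> orientations E" "O2 \<in> orientations E" "O2' \<in> orientations E"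
    and "J_class E Cs v = J_class E Cs v'" "R_class E Cs O1 = R_class E Cs O1'"
    and "J_equiv E Cs (v + O1) O2" "J_equiv E Cs (v' + O1') O2'"
  shows "R_class E Cs O2 = R_class E Cs O2'"
proof -
  have "J_equiv E Cs v v'" using assms(5) J_class_eq_iff by blast
  then have "J_equiv E Cs (v + O1) (v' + O1)" by (simp only: J_add_right)
  moreover have "J_equiv E Cs (v' + O1) (v' + O1')"
    using assms R_class_eq_iff by (simp only: J_add_left)
  ultimately have "J_equiv E Cs O2 O2'" using assms(7,8) J_trans J_sym by blast
  then show ?thesis using R_class_eq_iff assms by blast
qed

lemma jac_action_eq:
  assumes "v \<in> int_vecs E" "O1 \<in> orientations E" "O2 \<in> orientations E" "J_equiv E Cs (v + O1) O2"
  shows "jac_action E Cs (J_class E Cs v) (R_class E Cs O1) = R_class E Cs O2"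
proof -
  have "R_class E Cs O1 \<in> reversal_classes E Cs" using assms by (simp add: reversal_classes_def)
  moreover have "(THE \<Omega>'. \<exists>w \<in> int_vecs E. \<exists>P1 \<in> orientations E. \<exists>P2 \<in> orientations E.
       J_class E Cs v = J_class E Cs w \<and> R_class E Cs O1 = R_class E Cs P1 \<and>
       J_equiv E Cs (w + P1) P2 \<and> \<Omega>' = R_class E Cs P2) = R_class E Cs O2"
    using assms jac_action_well_defined[OF assms(2) _ assms(3) _ _ _ assms(4)]
    by (intro the_equality) metis+
  ultimately show ?thesis unfolding jac_action_def by simp
qed

lemma half_shift_J_orientation:
  assumes "v \<in> int_vecs E" "O1 \<in> orientations E"
  obtains O2 where "O2 \<in> orientations E" "J_equiv E Cs (v + O1) O2"
  using half_vec_J_orientation[OF half_vecs_shift[OF assms(1) orientation_half[OF assms(2)]]] .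

lemma jac_action_simply_transitive:
  "simply_transitive_action (Jac E Cs) (reversal_classes E Cs) (jac_action E Cs)"
proof -
  define r where "r \<Omega> = (SOME P. P \<in> orientations E \<and> R_class E Cs P = \<Omega>)" for \<Omega>
  have r: "r \<Omega> \<in> orientations E \<and> R_class E Cs (r \<Omega>) = \<Omega>" if "\<Omega> \<in> reversal_classes E Cs" for \<Omega>
  proof -
    have "\<exists>P. P \<in> orientations E \<and> R_class E Cs P = \<Omega>"
      using that unfolding reversal_classes_def by blast
    then show ?thesis unfolding r_def by (rule someI_ex)
  qed
  have act: "jac_action E Cs (J_class E Cs v) \<Omega> \<in> reversal_classes E Cs \<and>
      J_equiv E Cs (v + r \<Omega>) (r (jac_action E Cs (J_class E Cs v) \<Omega>))"
    if v: "v \<in> int_vecs E" and \<Omega>: "\<Omega> \<in> reversal_classes E Cs" for v \<Omega>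
  proof -
    obtain O2 where O2: "O2 \<in> orientations E" "J_equiv E Cs (v + r \<Omega>) O2"
      by (rule half_shift_J_orientation[OF v]) (use r[OF \<Omega>] in blast)+
    have eq: "jac_action E Cs (J_class E Cs v) \<Omega> = R_class E Cs O2"
      using jac_action_eq[OF v _ O2] r[OF \<Omega>] by simp
    have mem: "R_class E Cs O2 \<in> reversal_classes E Cs" using O2 by (simp add: reversal_classes_def)
    have "J_equiv E Cs O2 (r (R_class E Cs O2))"
      using r[OF mem] R_class_eq_iff[OF O2(1), of "r (R_class E Cs O2)"] by simp
    then show ?thesis using mem J_trans[OF O2(2)] by (simp add: eq)
  qed
  show ?thesis
  proof (rule representative_action[of _ r])
    show "reversal_classes E Cs \<noteq> {}" using orientations_nonempty by (simp add: reversal_classes_def)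
    show "r \<Omega> \<in> half_vecs E" if "\<Omega> \<in> reversal_classes E Cs" for \<Omega>
      using r[OF that] orientation_half by blast
    show "\<Omega> = \<Omega>'" if "\<Omega> \<in> reversal_classes E Cs" "\<Omega>' \<in> reversal_classes E Cs"
      "J_equiv E Cs (r \<Omega>) (r \<Omega>')" for \<Omega> \<Omega>'
      using r[OF that(1)] r[OF that(2)] R_class_eq_iff[of "r \<Omega>" "r \<Omega>'"] that(3) by simp
    show "jac_action E Cs g \<in> extensional (reversal_classes E Cs)" for g
      unfolding jac_action_def by (rule restrict_extensional)
  qed (use act in blast)+
qed

end


section \<open>Acyclic signatures and bases\<close>

context regular_orthogonal_representation
begin

section \<open>Linear functionals positive on an acyclic signature\<close>

definition weight :: "('a + 'a \<Rightarrow> rat) \<Rightarrow> ('a + 'a \<Rightarrow> rat) \<Rightarrow> rat" where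
  "weight w u = (\<Sum>x\<in>E <+> E. w x * u x)"

lemma weight_uminus: "weight w (- u) = - weight w u"
  by (simp add: weight_def sum_negf)

lemma weight_diff: "weight w (u - v) = weight w u - weight w v"
  by (simp add: weight_def sum_subtractf right_diff_distrib)

lemma weight_sum: "weight w (\<lambda>x. \<Sum>j\<in>J. a j * F j x) = (\<Sum>j\<in>J. a j * weight w (F j))"
proof -
  have "weight w (\<lambda>x. \<Sum>j\<in>J. a j * F j x) = (\<Sum>x\<in>E <+> E. \<Sum>j\<in>J. a j * (w x * F j x))"
    by (simp add: weight_def sum_distrib_left mult.left_commute)
  also have "\<dots> = (\<Sum>j\<in>J. a j * weight w (F j))"
    by (subst sum.swap) (simp add: weight_def sum_distrib_left)
  finally show ?thesis .
qed

text \<open>Acyclicity for real coefficients covers rational ones, so Gordan's theorem over the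
  rationals supplies a rational functional.\<close>

lemma acyclic_weight:
  assumes sig: "circuit_signature Cs \<sigma>" and acyclic: "acyclic_signature \<sigma>"
  obtains w where "\<And>C. C \<in> \<sigma> \<Longrightarrow> 0 < weight w C"
proof -
  have sub: "\<sigma> \<subseteq> Cs" using sig by (simp add: circuit_signature_def)
  then have "finite \<sigma>" using finite_Cs finite_subset by blast
  then obtain w where "\<And>C. C \<in> \<sigma> \<Longrightarrow> 0 < (\<Sum>x\<in>E <+> E. w x * C x)"
  proof (rule gordan[OF _ finite_ground_sum])
    fix c :: "('a + 'a \<Rightarrow> rat) \<Rightarrow> rat"
    assume c: "\<And>C. C \<in> \<sigma> \<Longrightarrow> 0 \<le> c C" "\<And>x. x \<in> E <+> E \<Longrightarrow> (\<Sum>C\<in>\<sigma>. c C * C x) = 0"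
    have "(\<Sum>C\<in>\<sigma>. c C * C x) = 0" for x
    proof (cases "x \<in> E <+> E")
      case False
      then show ?thesis using circuit_outside sub by (intro sum.neutral) auto
    qed (rule c(2))
    then have "(\<Sum>C\<in>\<sigma>. real_of_rat (c C) * real_of_rat (C x)) = 0" for x
      by (simp only: of_rat_mult[symmetric] of_rat_sum[symmetric] of_rat_0)
    then have "\<forall>C\<in>\<sigma>. real_of_rat (c C) = 0"
      using acyclic[unfolded acyclic_signature_def, rule_format, of "\<lambda>C. real_of_rat (c C)"] c(1)
      by simp
    then show "\<forall>C\<in>\<sigma>. c C = 0" by simp
  qed blast
  then show thesis using that unfolding weight_def by blast
qed

end

section \<open>Signatures given by the sign of a weight\<close>

locale weighted_signature = regular_orthogonal_representation E Bs Cs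
  for E :: "'a set" and Bs and Cs +
  fixes \<sigma> and w :: "'a + 'a \<Rightarrow> rat"
  assumes signature: "circuit_signature Cs \<sigma>"
    and weight_pos: "C \<in> \<sigma> \<Longrightarrow> 0 < weight w C"
begin

abbreviation \<beta> where "\<beta> \<equiv> beta E Bs \<sigma>"

lemma signature_iff_weight: "C \<in> Cs \<Longrightarrow> C \<in> \<sigma> \<longleftrightarrow> 0 < weight w C"
  using signature_cases[OF signature] weight_pos[of C] weight_pos[of "- C"]
  by (auto simp: weight_uminus)

lemma weight_nonzero: "C \<in> Cs \<Longrightarrow> weight w C \<noteq> 0"
  using signature_cases[OF signature] weight_pos[of C] weight_pos[of "- C"]
  by (fastforce simp: weight_uminus)

lemma beta_base:
  assumes "B \<in> Bs" "fundamental B F" "x \<in> (E <+> E) - B"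
  shows "\<beta> B (base x) = (if 0 < weight w (F x) then 1/2 else - 1/2)"
proof -
  have "x \<in> {Inl (base x), Inr (base x)} - B" using assms(3) by (cases x) auto
  then show ?thesis
    using beta_eq[OF signature assms(1,2), of "base x" x] assms(3)
      signature_iff_weight[OF fundamental_in_Cs[OF assms(2,3)]] by simp
qed

lemma cobasis_element:
  assumes "B \<in> Bs" "e \<in> E"
  obtains x where "x \<in> (E <+> E) - B" "base x = e"
  using basis_iff[OF assms(1), of "Inl e"] assms(2)
  by (metis DiffI Inl_in_ground_iff Inr_in_ground_iff base_simps(1,2) star.simps(1))

lemma beta_orientation:
  assumes B: "B \<in> Bs"
  shows "\<beta> B \<in> orientations E"
proof -
  obtain F where F: "fundamental B F" using fundamental_exists[OF B] .
  have "\<beta> B e = 1/2 \<or> \<beta> B e = - 1/2" if "e \<in> E" for e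
    using cobasis_element[OF B that] beta_base[OF B F] by metis
  then show ?thesis by (simp add: orientations_def rat_vecs_def beta_def)
qed

text \<open>In the expansion of \<open>u\<close> over \<open>B\<close> the weight of
  \<open>F x\<close> has the sign of \<beta>, so every term of the weight of \<open>u\<close> is
  nonnegative, and positive where \<open>u x\<close> is nonzero.\<close>

lemma weight_pos_of_beta:
  assumes B: "B \<in> Bs" and u: "u \<in> lagrangian" "u \<noteq> (\<lambda>x. 0)"
    and sgn: "\<And>x. x \<in> (E <+> E) - B \<Longrightarrow> 0 \<le> u x * \<beta> B (base x)"
  shows "0 < weight w u"
proof -
  obtain F where F: "fundamental B F" using fundamental_exists[OF B] .
  have "u = (\<lambda>z. \<Sum>x\<in>(E <+> E) - B. u x * F x z)"
    using lagrangian_expand[OF B F u(1)] by (rule ext)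
  then have eq: "weight w u = (\<Sum>x\<in>(E <+> E) - B. u x * weight w (F x))"
    using weight_sum[of w u F "(E <+> E) - B"] by simp
  have nonneg: "0 \<le> u x * weight w (F x)" if "x \<in> (E <+> E) - B" for x
    using sgn[OF that] beta_base[OF B F that]
    by (auto simp: zero_le_mult_iff split: if_splits)
  obtain y where y: "y \<in> (E <+> E) - B" "u y \<noteq> 0"
    using lagrangian_eq_0[OF B u(1)] u(2) by blast
  then have "u y * weight w (F y) \<noteq> 0"
    using weight_nonzero fundamental_in_Cs[OF F] by simp
  then show ?thesis
    unfolding eq using nonneg y finite_ground_sum
    by (intro sum_pos2[of _ y]) (auto simp: less_le)
qed

section \<open>Injectivity modulo J-equivalence\<close>

text \<open>First the two orientations are shown to be equal, then the two bases. In either step a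
  failure gives a nonzero \<open>u\<close> for which both \<open>u\<close> and \<open>- u\<close>
  have positive weight.\<close>

lemma beta_J_inj:
  assumes B: "B1 \<in> Bs" "B2 \<in> Bs" and J: "J_equiv E Cs (\<beta> B1) (\<beta> B2)"
  shows "B1 = B2"
proof -
  have "\<beta> B1 = \<beta> B2"
  proof -
    obtain u where u: "u \<in> lagrangian" "\<And>x. u x \<in> \<int>" "\<beta> B2 - \<beta> B1 = proj u"
      using J unfolding J_equiv_def by (rule lattice_lift) blast
    then have eq: "\<beta> B2 = \<beta> B1 + proj u" by (metis add_diff_cancel_left' add.commute diff_add_cancel)
    note c = orientation_diff_lift[OF beta_orientation[OF B(1)] beta_orientation[OF B(2)] u(1,2) eq]
    \<comment> \<open>A nonzero entry of \<open>u\<close> marks a coordinate where the orientations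
      are opposite; it has the sign of the second and is opposite to the first.\<close>
    have val: "u x = 0 \<or> u x = 2 * \<beta> B2 (base x) \<and> u x = - 2 * \<beta> B1 (base x)" for x
    proof (cases "u x = 0")
      case False
      then have "proj u (base x) = u x" using c(1)[of x] by (cases x) (auto simp: proj_def)
      then have "\<beta> B2 (base x) - \<beta> B1 (base x) = u x" by (simp add: eq)
      moreover have "base x \<in> E" using False lagrangian_outside[OF u(1)] by auto
      ultimately show ?thesis
        using False beta_orientation[OF B(1)] beta_orientation[OF B(2)]
        by (force simp: orientations_def)
    qed simp
    have "u = (\<lambda>x. 0)"
    proof (rule ccontr)
      assume nz: "u \<noteq> (\<lambda>x. 0)"
      have "0 < weight w u"
      proof (rule weight_pos_of_beta[OF B(2) u(1) nz])
        show "0 \<le> u x * \<beta> B2 (base x)" for x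
        proof -
          have "u x = 0 \<or> u x = 2 * \<beta> B2 (base x)" using val by blast
          then show ?thesis by auto
        qed
      qed
      moreover have "0 < weight w (- u)"
      proof (rule weight_pos_of_beta[OF B(1)])
        show "- u \<in> lagrangian" by (rule lagrangian_uminus[OF u(1)])
        show "- u \<noteq> (\<lambda>x. 0)" using nz by (auto simp: fun_eq_iff)
        show "0 \<le> (- u) x * \<beta> B1 (base x)" for x
        proof -
          have "u x = 0 \<or> u x = - 2 * \<beta> B1 (base x)" using val by blast
          then show ?thesis by auto
        qed
      qed
      ultimately show False by (simp add: weight_uminus)
    qed
    then show ?thesis using eq by (simp add: proj_zero)
  qed
  note \<beta>_eq = this
  show ?thesis
  proof (rule ccontr)
    assume ne: "B1 \<noteq> B2"
    define D where "D = ((E <+> E) - B1) \<inter> B2"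
    have "D \<noteq> {}"
    proof
      assume "D = {}"
      then have "B2 \<subseteq> B1" using basis_subset[OF B(2)] by (auto simp: D_def)
      moreover have "card B1 = card B2" using bases_transversal B by (simp add: transversal_def)
      moreover have "finite B1" using basis_subset[OF B(1)] finite_ground_sum finite_subset by blast
      ultimately show False using card_subset_eq ne by metis
    qed
    then obtain y where y: "y \<in> D" by blast
    define s where "s x = (if \<beta> B1 (base x) < 0 then -1 else 1 :: rat)" for x
    have D: "D \<subseteq> (E <+> E) - B1" by (auto simp: D_def)
    \<comment> \<open>With \<open>t = - 1\<close>, \<open>u\<close> follows the common orientation
      on \<open>D\<close> and opposes it on the stars of \<open>D\<close>. An element outside
      \<open>B2\<close> is either the star of an element of \<open>D\<close> or outside both bases,
      where \<open>u\<close> vanishes; so \<open>- u\<close> is suitable for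
      \<open>B2\<close>.\<close>
    obtain u where u: "u \<in> lagrangian" "\<And>x. x \<in> (E <+> E) - B1 - D \<Longrightarrow> u x = 0"
      "\<And>x. x \<in> D \<Longrightarrow> 0 \<le> s x * u x" "\<And>x. x \<in> D \<Longrightarrow> 0 \<le> - 1 * s x * u (star x)"
      "\<And>x. x \<in> D \<Longrightarrow> 0 < s x * u x + - 1 * s x * u (star x)"
    proof (rule lagrangian_signs[OF B(1) D, of s "- 1"])
      show "s x * s x = 1" for x by (simp add: s_def)
    qed simp_all
    have nz: "u \<noteq> (\<lambda>x. 0)" using u(5)[OF y] by auto
    have "0 < weight w u"
    proof (rule weight_pos_of_beta[OF B(1) u(1) nz])
      fix x assume x: "x \<in> (E <+> E) - B1"
      show "0 \<le> u x * \<beta> B1 (base x)"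
        using u(2)[of x] u(3)[of x] x
        by (cases "x \<in> D") (auto simp: s_def mult_nonpos_nonpos split: if_splits)
    qed
    moreover have "0 < weight w (- u)"
    proof (rule weight_pos_of_beta[OF B(2)])
      show "- u \<in> lagrangian" by (rule lagrangian_uminus[OF u(1)])
      show "- u \<noteq> (\<lambda>x. 0)" using nz by (auto simp: fun_eq_iff)
      fix x assume x: "x \<in> (E <+> E) - B2"
      show "0 \<le> (- u) x * \<beta> B2 (base x)"
      proof (cases "x \<in> B1")
        case True
        then have "star x \<in> D"
          using x basis_iff[OF B(1), of x] basis_iff[OF B(2), of x] by (auto simp: D_def)
        then show ?thesis
          using u(4)[of "star x"] unfolding \<beta>_eq[symmetric]
          by (auto simp: s_def mult_le_0_iff zero_le_mult_iff split: if_splits)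
      next
        case False
        then show ?thesis using u(2)[of x] x by (auto simp: D_def)
      qed
    qed
    ultimately show False by (simp add: weight_uminus)
  qed
qed


section \<open>Surjectivity modulo J-equivalence\<close>

text \<open>Reversing a circuit outside \<open>\<sigma>\<close> strictly increases the weight, so an orientation of maximal
  weight in its class admits no such reversal.\<close>

lemma compatible_orientation:
  assumes O1: "O1 \<in> orientations E"
  obtains O2 where "O2 \<in> orientations E" "J_equiv E Cs O1 O2"
    "\<And>C. C \<in> Cs \<Longrightarrow> (\<And>x. 0 \<le> C x * O2 (base x)) \<Longrightarrow> 0 < weight w C"
proof -
  \<comment> \<open>Lifts of the orientations J-equivalent to \<open>O1\<close>. Projection is
    injective on Lagrangian vectors, so there are finitely many and one has maximal weight.\<close>
  define S where "S = {u \<in> lagrangian. proj u \<in> circuit_lattice E Cs \<and> O1 + proj u \<in> orientations E}"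
  have inj: "inj_on (\<lambda>u. O1 + proj u) S"
  proof (rule inj_onI)
    fix u v assume uv: "u \<in> S" "v \<in> S" "O1 + proj u = O1 + proj v"
    have "u - v \<in> lagrangian" using uv(1,2) by (intro lagrangian_diff) (simp_all add: S_def)
    moreover have "proj (u - v) = 0" using uv(3) unfolding proj_diff by simp
    ultimately have "u - v = (\<lambda>x. 0)" by (rule proj_inj)
    from fun_cong[OF this] show "u = v" by (intro ext) simp
  qed
  have fin: "finite S"
  proof (rule inj_on_finite[OF inj])
    show "(\<lambda>u. O1 + proj u) ` S \<subseteq> orientations E" by (rule image_subsetI) (simp add: S_def)
  qed (rule finite_orientations[OF finite_ground])
  have "(\<lambda>x. 0) \<in> S"
    using O1 lagrangian_zero lattice_zero by (simp add: S_def proj_zero)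
  then have ne: "S \<noteq> {}" by blast
  define M where "M = Max (weight w ` S)"
  have "M \<in> weight w ` S" unfolding M_def using fin ne by (intro Max_in) auto
  then obtain u where u: "u \<in> S" "weight w u = M" by blast
  have max: "weight w v \<le> weight w u" if "v \<in> S" for v
    unfolding u(2) M_def using fin that by (intro Max_ge) auto
  define O2 where "O2 = O1 + proj u"
  have O2: "O2 \<in> orientations E" using u by (simp add: S_def O2_def)
  show thesis
  proof (rule that[OF O2])
    show "J_equiv E Cs O1 O2" using u by (simp add: S_def O2_def J_equiv_def)
    fix C assume C: "C \<in> Cs" and sgn: "\<And>x. 0 \<le> C x * O2 (base x)"
    show "0 < weight w C"
    proof (rule ccontr)
      assume "\<not> 0 < weight w C"
      then have neg: "weight w C < 0" using weight_nonzero[OF C] by simp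
      \<comment> \<open>The entries of \<open>C\<close> are those of twice \<open>O2\<close> on its
        support, so subtracting \<open>proj C\<close> negates \<open>O2\<close> there and yields an
        orientation of larger weight.\<close>
      have Cx: "C x = 0 \<or> C x = 2 * O2 (base x)" for x
      proof (cases "C x = 0")
        case False
        then have "base x \<in> E" using circuit_outside[OF C] by auto
        then have "O2 (base x) = 1/2 \<or> O2 (base x) = -1/2" using O2 by (simp add: orientations_def)
        then show ?thesis using circuit_entry[OF C, of x] sgn[of x] by auto
      qed simp
      have "0 \<le> C (Inl e) * C (Inr e)" for e
        using Cx[of "Inl e"] Cx[of "Inr e"] by auto
      then have compl: "C x = 0 \<or> C (star x) = 0" for x
        by (intro isotropic_complementary'[OF circuit_in_lagrangian[OF C]])
      have "proj C e = 0 \<or> proj C e = 2 * O2 e" for e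
        using Cx[of "Inl e"] Cx[of "Inr e"] compl[of "Inl e"] by (auto simp: proj_def)
      then have mix: "(O2 - proj C) e = O2 e \<or> (O2 - proj C) e = (- O2) e" for e
        by (rule disjE[of "proj C e = 0" "proj C e = 2 * O2 e"]) simp_all
      have "- O2 \<in> orientations E" using O2 by (auto simp: orientations_def rat_vecs_def)
      then have "O2 - proj C \<in> orientations E" using mix by (rule orientations_mix[OF O2])
      moreover have "O1 + proj (u - C) = O2 - proj C" by (simp add: O2_def proj_diff)
      moreover have "proj (u - C) \<in> circuit_lattice E Cs"
        using lattice_add[of "proj u" "- proj C"] lattice_uminus lattice_proj[OF C] u
        by (simp add: S_def proj_diff)
      ultimately have "u - C \<in> S"
        using lagrangian_diff circuit_in_lagrangian[OF C] u by (simp add: S_def)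
      then show False using max[of "u - C"] neg by (simp add: weight_diff)
    qed
  qed
qed

lemma basis_of_circuit_free:
  assumes T: "transversal E T" and free: "\<And>C. C \<in> Cs \<Longrightarrow> \<exists>x\<in>(E <+> E) - T. C x \<noteq> 0"
  shows "T \<in> Bs"
proof (rule ccontr)
  assume "T \<notin> Bs"
  have "\<not> T \<subseteq> B" if B: "B \<in> Bs" for B
  proof
    assume "T \<subseteq> B"
    moreover have "card T = card B"
      using T bases_transversal[OF B] by (simp add: transversal_def)
    moreover have "finite B" using basis_subset[OF B] finite_ground_sum finite_subset by blast
    ultimately have "T = B" by (simp add: card_subset_eq)
    then show False using B \<open>T \<notin> Bs\<close> by simp
  qed
  moreover have "subtransversal E T" using T by (auto simp: subtransversal_def)
  ultimately obtain K where K: "circuit E Bs K" "K \<subseteq> T" using circuit_exists by metis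
  obtain C where "C \<in> Cs" "supp C = K" using circuit_vector[OF K(1)] .
  then show False using free[of C] K(2) by (auto simp: supp_def)
qed

text \<open>A compatible orientation makes the linear complementarity problem given by \<open>w\<close> feasible; the
  zero pattern of its strictly complementary solution is the required basis.\<close>

lemma complementary_weight:
  assumes compat: "\<And>C. C \<in> Cs \<Longrightarrow> (\<And>x. 0 \<le> C x * P (base x)) \<Longrightarrow> 0 < weight w C"
  obtains a where "\<And>x. 0 \<le> a x" "\<And>x. x \<in> E <+> E \<Longrightarrow> (a x = 0) \<noteq> (a (star x) = 0)"
    "\<And>v. v \<in> lagrangian \<Longrightarrow>
      weight w v = (\<Sum>x\<in>E <+> E. (if P (base x) < 0 then -1 else 1) * a x * v x)"
proof -
  define s where "s x = (if P (base x) < 0 then -1 else 1 :: rat)" for x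
  have ss: "s x * s x = 1" "s x * (s x * r) = r" "s (star x) = s x" for x r
    by (auto simp: s_def)
  obtain B where B: "B \<in> Bs" using obtain_basis .
  obtain F where F: "fundamental B F" using fundamental_exists[OF B] .
  let ?N = "(E <+> E) - B"
  have finN: "finite ?N" using finite_ground_sum by simp
  \<comment> \<open>The block of the fundamental matrix conjugated by the signs of \<open>P\<close>;
    \<open>q\<close> holds the signed weights of the fundamental circuits.\<close>
  define A where "A x y = s x * s y * F y (star x)" for x y
  define q where "q x = s x * weight w (F x)" for x
  obtain X Y where XY: "\<And>x. x \<in> ?N \<Longrightarrow> Y x = q x + (\<Sum>y\<in>?N. A x y * X y)"
    "\<And>x. x \<in> ?N \<Longrightarrow> 0 \<le> X x" "\<And>x. x \<in> ?N \<Longrightarrow> 0 \<le> Y x"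
    "\<And>x. x \<in> ?N \<Longrightarrow> (X x = 0) \<noteq> (Y x = 0)"
  proof (rule skew_complementarity[OF finN, of A q])
    show "A x y = - A y x" if "x \<in> ?N" "y \<in> ?N" for x y
      using fundamental_skew[OF B F that(2,1)] by (simp add: A_def)
  next
    fix X assume X: "\<And>x. x \<in> ?N \<Longrightarrow> 0 \<le> X x" "\<And>x. x \<in> ?N \<Longrightarrow> 0 \<le> (\<Sum>y\<in>?N. A x y * X y)"
    \<comment> \<open>A feasible direction is a Lagrangian vector with the signs of \<open>P\<close>
      on all pairs. It splits conformally into circuits compatible with \<open>P\<close>, each of
      positive weight, so its weight, which is \<open>q\<close> applied to \<open>X\<close>, is
      nonnegative.\<close>
    define u where "u = (\<lambda>z. \<Sum>y\<in>?N. (s y * X y) * F y z)"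
    have u: "u \<in> lagrangian"
      unfolding u_def using finN fundamental_in_Cs[OF F] circuit_in_lagrangian
      by (intro lagrangian_sum) auto
    have "s x * u x = X x" if x: "x \<in> ?N" for x
    proof -
      have "u x = (\<Sum>y\<in>?N. if y = x then s x * X x else 0)"
        unfolding u_def
      proof (intro sum.cong refl)
        fix y assume "y \<in> ?N"
        then have "F y x = of_bool (x = y)" using fundamental_delta[OF F _ x] by blast
        then show "s y * X y * F y x = (if y = x then s x * X x else 0)" by simp
      qed
      then show ?thesis using finN x by (simp add: ss)
    qed
    then have su1: "0 \<le> s x * u x" if "x \<in> ?N" for x using that X(1) by simp
    have "s x * u (star x) = (\<Sum>y\<in>?N. A x y * X y)" for x
      unfolding u_def A_def sum_distrib_left by (simp add: mult_ac)
    then have su2: "0 \<le> s x * u (star x)" if "x \<in> ?N" for x using that X(2) by simp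
    have su: "0 \<le> s x * u x" for x
    proof (cases "x \<in> E <+> E")
      case True
      then show ?thesis
        using su1[of x] su2[of "star x"] basis_iff[OF B True] by (cases "x \<in> B") (auto simp: ss)
    qed (simp add: lagrangian_outside[OF u])
    have "0 \<le> u (Inl e) * u (Inr e)" for e
      using su[of "Inl e"] su[of "Inr e"]
      by (auto simp: s_def mult_le_0_iff zero_le_mult_iff split: if_splits)
    note compl = isotropic_complementary'[OF u this]
    obtain c where c: "\<forall>C\<in>Cs. 0 \<le> c C \<and> (c C \<noteq> 0 \<longrightarrow> conformal C u)"
      "\<forall>x. u x = (\<Sum>C\<in>Cs. c C * C x)" using conformal_decomposition[OF u compl] by blast
    have "0 \<le> c C * weight w C" if C: "C \<in> Cs" for C
    proof (cases "c C = 0")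
      case False
      then have conf: "conformal C u" using c(1) C by blast
      have "0 \<le> C x * P (base x)" for x
      proof (cases "C x = 0")
        case False
        then have "0 < C x * u x" using conf by (simp add: conformal_def)
        then show ?thesis using su[of x]
          by (auto simp: s_def zero_less_mult_iff zero_le_mult_iff mult_le_0_iff split: if_splits)
      qed simp
      then have "0 < weight w C" using compat C by blast
      then show ?thesis using c(1) C by simp
    qed simp
    then have "0 \<le> (\<Sum>C\<in>Cs. c C * weight w C)" by (intro sum_nonneg)
    also have "\<dots> = weight w (\<lambda>x. \<Sum>C\<in>Cs. c C * C x)" using weight_sum[of w c "\<lambda>C. C" Cs] by simp
    also have "(\<lambda>x. \<Sum>C\<in>Cs. c C * C x) = u" using c(2) by auto
    also have "weight w u = (\<Sum>x\<in>?N. q x * X x)"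
      unfolding u_def weight_sum q_def by (simp add: mult_ac)
    finally show "0 \<le> (\<Sum>x\<in>?N. q x * X x)" .
  qed blast
  \<comment> \<open>The two complementary vectors merged into one on the ground set:
    \<open>Y\<close> off \<open>B\<close> and \<open>X\<close>, moved by \<open>star\<close>, on
    \<open>B\<close>.\<close>
  define a where "a x = (if x \<in> ?N then Y x else if x \<in> B then X (star x) else 0)" for x
  have a: "a x = Y x" "a (star x) = X x" if "x \<in> ?N" for x
    using that basis_iff[OF B, of x] by (auto simp: a_def)
  have star_N: "star x \<in> ?N" if "x \<in> B" for x
    using that basis_iff[OF B, of x] basis_subset[OF B] by auto
  show thesis
  proof (rule that[of a])
    show "0 \<le> a x" for x using XY(2)[of "star x"] XY(3)[of x] star_N[of x] by (auto simp: a_def)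
    show "(a x = 0) \<noteq> (a (star x) = 0)" if "x \<in> E <+> E" for x
    proof (cases "x \<in> B")
      case True
      then show ?thesis using a[OF star_N] XY(4)[OF star_N] by simp
    next
      case False
      then show ?thesis using a[of x] XY(4)[of x] that by simp
    qed
  next
    fix v assume v: "v \<in> lagrangian"
    \<comment> \<open>The complementarity equation solved for \<open>q\<close>, with the signs
      cancelled by \<open>s x * s x = 1\<close>.\<close>
    have q: "weight w (F x) = s x * Y x - (\<Sum>y\<in>?N. s y * X y * F y (star x))" if "x \<in> ?N" for x
    proof -
      have "s x * Y x = s x * q x + (\<Sum>y\<in>?N. s x * (A x y * X y))"
        unfolding XY(1)[OF that] by (simp add: distrib_left sum_distrib_left)
      also have "(\<Sum>y\<in>?N. s x * (A x y * X y)) = (\<Sum>y\<in>?N. s y * X y * F y (star x))"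
        by (intro sum.cong refl)
            (simp add: A_def mult.assoc ss mult.left_commute[of _ "F _ _"] mult.commute)
      finally show ?thesis by (simp add: q_def ss)
    qed
    \<comment> \<open>Orthogonality of \<open>v\<close> to \<open>F y\<close> converts the matrix
      terms into entries of \<open>v\<close> on \<open>B\<close>.\<close>
    have pf: "(\<Sum>x\<in>?N. v x * F y (star x)) = - v (star y)" if "y \<in> ?N" for y
      using pairing_fundamental[OF B F that, of v] v fundamental_in_Cs[OF F that]
      by (simp add: lagrangian_def eq_neg_iff_add_eq_0)
    have "v = (\<lambda>z. \<Sum>x\<in>?N. v x * F x z)"
      using lagrangian_expand[OF B F v] by (rule ext)
    then have "weight w v = (\<Sum>x\<in>?N. v x * weight w (F x))"
      using weight_sum[of w v F ?N] by simp
    also have "\<dots> = (\<Sum>x\<in>?N. s x * Y x * v x) - (\<Sum>x\<in>?N. \<Sum>y\<in>?N. s y * X y * (v x * F y (star x)))"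
      by (simp add: q right_diff_distrib sum_subtractf sum_distrib_left mult_ac)
    also have "(\<Sum>x\<in>?N. \<Sum>y\<in>?N. s y * X y * (v x * F y (star x))) =
        (\<Sum>y\<in>?N. \<Sum>x\<in>?N. s y * X y * (v x * F y (star x)))"
      by (rule sum.swap)
    also have "\<dots> = (\<Sum>y\<in>?N. s y * X y * - v (star y))"
      by (intro sum.cong refl) (simp only: sum_distrib_left[symmetric] pf)
    also have "(\<Sum>x\<in>?N. s x * Y x * v x) - \<dots> =
        (\<Sum>x\<in>?N. s x * a x * v x + s (star x) * a (star x) * v (star x))"
      by (simp add: a ss sum.distrib sum_negf)
    also have "\<dots> = (\<Sum>x\<in>E <+> E. s x * a x * v x)"
      by (rule sum_cotransversal[OF finite_ground bases_transversal[OF B], symmetric])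
    finally show "weight w v = (\<Sum>x\<in>E <+> E. (if P (base x) < 0 then -1 else 1) * a x * v x)"
      by (simp add: s_def)
  qed
qed

text \<open>\<open>B\<close> is the zero set of \<open>a\<close>. A circuit inside \<open>B\<close>
  would have weight 0, so \<open>B\<close> is a basis. In the weight of \<open>F x\<close> only
  \<open>x\<close> itself contributes, which leaves \<open>s x * a x\<close> and hence the sign of
  \<open>P\<close>.\<close>

lemma compatible_is_beta:
  assumes P: "P \<in> orientations E"
    and compat: "\<And>C. C \<in> Cs \<Longrightarrow> (\<And>x. 0 \<le> C x * P (base x)) \<Longrightarrow> 0 < weight w C"
  obtains B where "B \<in> Bs" "\<beta> B = P"
proof -
  define s where "s x = (if P (base x) < 0 then -1 else 1 :: rat)" for x
  obtain a where a: "\<And>x. 0 \<le> a x" "\<And>x. x \<in> E <+> E \<Longrightarrow> (a x = 0) \<noteq> (a (star x) = 0)"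
    "\<And>v. v \<in> lagrangian \<Longrightarrow> weight w v = (\<Sum>x\<in>E <+> E. s x * a x * v x)"
  proof (rule complementary_weight[of P, folded s_def], goal_cases)
    case (1 C)
    show ?case by (rule compat[OF 1(2,3)])
  next
    case (2 a)
    show thesis by (rule 2(1)[OF 2(2-4)])
  qed
  define B where "B = {x \<in> E <+> E. a x = 0}"
  have "transversal E B"
    unfolding transversal_iff[OF finite_ground]
  proof (intro conjI ballI)
    show "star x \<in> B \<longleftrightarrow> x \<notin> B" if "x \<in> E <+> E" for x
      using a(2)[OF that] that by (simp add: B_def)
  qed (simp add: B_def)
  then have B: "B \<in> Bs"
  proof (rule basis_of_circuit_free)
    fix C assume C: "C \<in> Cs"
    show "\<exists>x\<in>(E <+> E) - B. C x \<noteq> 0"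
    proof (rule ccontr)
      assume none: "\<not> (\<exists>x\<in>(E <+> E) - B. C x \<noteq> 0)"
      have "s x * a x * C x = 0" if "x \<in> E <+> E" for x
      proof (cases "x \<in> B")
        case True
        then show ?thesis by (simp add: B_def)
      next
        case False
        then have "C x = 0" using none that by blast
        then show ?thesis by simp
      qed
      then have "weight w C = 0"
        unfolding a(3)[OF circuit_in_lagrangian[OF C]] by (simp add: sum.neutral)
      then show False using weight_nonzero[OF C] by simp
    qed
  qed
  obtain F where F: "fundamental B F" using fundamental_exists[OF B] .
  have "\<beta> B (base x) = P (base x)" if x: "x \<in> (E <+> E) - B" for x
  proof -
    have "weight w (F x) = (\<Sum>z\<in>E <+> E. if z = x then s x * a x else 0)"
      unfolding a(3)[OF circuit_in_lagrangian[OF fundamental_in_Cs[OF F x]]]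
    proof (intro sum.cong refl)
      fix z assume z: "z \<in> E <+> E"
      show "s z * a z * F x z = (if z = x then s x * a x else 0)"
      proof (cases "z \<in> B")
        case True
        then show ?thesis using x by (auto simp: B_def)
      next
        case False
        then have "F x z = of_bool (z = x)" using fundamental_delta[OF F x] z by blast
        then show ?thesis by simp
      qed
    qed
    also have "\<dots> = s x * a x" using x finite_ground_sum by simp
    finally have eq: "weight w (F x) = s x * a x" .
    have "0 < a x" using x a(1)[of x] by (auto simp: B_def)
    moreover have "P (base x) = 1/2 \<or> P (base x) = -1/2" using P x by (simp add: orientations_def)
    ultimately show ?thesis
      unfolding beta_base[OF B F x] eq by (cases "P (base x) < 0") (simp_all add: s_def)
  qed
  then have "\<beta> B e = P e" if "e \<in> E" for e using cobasis_element[OF B that] by metis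
  moreover have "\<beta> B e = P e" if "e \<notin> E" for e
    using P that by (simp add: beta_def orientations_def rat_vecs_def)
  ultimately have "\<beta> B = P" by blast
  then show thesis using that B by blast
qed

lemma beta_J_surj:
  assumes "O1 \<in> orientations E"
  obtains B where "B \<in> Bs" "J_equiv E Cs O1 (\<beta> B)"
proof -
  obtain O2 where O2: "O2 \<in> orientations E" "J_equiv E Cs O1 O2"
    "\<And>C. C \<in> Cs \<Longrightarrow> (\<And>x. 0 \<le> C x * O2 (base x)) \<Longrightarrow> 0 < weight w C"
    using compatible_orientation[OF assms] by blast
  obtain B where "B \<in> Bs" "\<beta> B = O2" using compatible_is_beta[OF O2(1,3)] by blast
  then show thesis using that O2(2) by blast
qed

end

context regular_orthogonal_representation
begin

section \<open>The bijection and the action on bases\<close>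

lemma acyclic_imp_weighted:
  assumes "circuit_signature Cs \<sigma>" "acyclic_signature \<sigma>"
  obtains w where "weighted_signature E Bs Cs \<sigma> w"
proof -
  obtain w where "\<And>C. C \<in> \<sigma> \<Longrightarrow> 0 < weight w C" using acyclic_weight[OF assms] by blast
  then have "weighted_signature E Bs Cs \<sigma> w"
    using assms(1) by unfold_locales
  then show thesis by (rule that)
qed

lemma beta_bar_bij:
  assumes "circuit_signature Cs \<sigma>" "acyclic_signature \<sigma>"
  shows "bij_betw (beta_bar E Bs Cs \<sigma>) Bs (reversal_classes E Cs)"
proof -
  obtain w where "weighted_signature E Bs Cs \<sigma> w" using acyclic_imp_weighted[OF assms] .
  then interpret weighted_signature E Bs Cs \<sigma> w .
  have "inj_on (beta_bar E Bs Cs \<sigma>) Bs"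
    using beta_J_inj R_class_eq_iff beta_orientation unfolding beta_bar_def by (intro inj_onI) simp
  moreover have "beta_bar E Bs Cs \<sigma> ` Bs = reversal_classes E Cs"
  proof
    show "beta_bar E Bs Cs \<sigma> ` Bs \<subseteq> reversal_classes E Cs"
      using beta_orientation by (auto simp: beta_bar_def reversal_classes_def)
    show "reversal_classes E Cs \<subseteq> beta_bar E Bs Cs \<sigma> ` Bs"
    proof
      fix \<Omega> assume "\<Omega> \<in> reversal_classes E Cs"
      then obtain P where P: "P \<in> orientations E" "\<Omega> = R_class E Cs P"
        by (auto simp: reversal_classes_def)
      obtain B where B: "B \<in> Bs" "J_equiv E Cs P (\<beta> B)" using beta_J_surj[OF P(1)] .
      then have "\<Omega> = beta_bar E Bs Cs \<sigma> B"
        using P R_class_eq_iff[OF P(1) beta_orientation[OF B(1)]] by (simp add: beta_bar_def)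
      then show "\<Omega> \<in> beta_bar E Bs Cs \<sigma> ` Bs" using B(1) by blast
    qed
  qed
  ultimately show ?thesis by (simp add: bij_betw_def)
qed

lemma beta_J:
  assumes "circuit_signature Cs \<sigma>" "acyclic_signature \<sigma>" "B \<in> Bs"
  shows "beta E Bs \<sigma> B \<in> orientations E"
    "B' \<in> Bs \<Longrightarrow> J_equiv E Cs (beta E Bs \<sigma> B) (beta E Bs \<sigma> B') \<Longrightarrow> B = B'"
proof -
  obtain w where "weighted_signature E Bs Cs \<sigma> w" using acyclic_imp_weighted[OF assms(1,2)] .
  then interpret weighted_signature E Bs Cs \<sigma> w .
  show "beta E Bs \<sigma> B \<in> orientations E" by (rule beta_orientation[OF assms(3)])
  show "B' \<in> Bs \<Longrightarrow> J_equiv E Cs (beta E Bs \<sigma> B) (beta E Bs \<sigma> B') \<Longrightarrow> B = B'"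
    by (rule beta_J_inj[OF assms(3)])
qed

lemma Gamma_act:
  assumes sig: "circuit_signature Cs \<sigma>" "acyclic_signature \<sigma>" and v: "v \<in> int_vecs E" and B: "B \<in> Bs"
  shows "Gamma E Bs Cs \<sigma> (J_class E Cs v) B \<in> Bs"
    "J_equiv E Cs (v + beta E Bs \<sigma> B) (beta E Bs \<sigma> (Gamma E Bs Cs \<sigma> (J_class E Cs v) B))"
proof -
  note bij = beta_bar_bij[OF sig]
  have \<beta>B: "beta E Bs \<sigma> B \<in> orientations E" by (rule beta_J(1)[OF sig B])
  obtain O2 where O2: "O2 \<in> orientations E" "J_equiv E Cs (v + beta E Bs \<sigma> B) O2"
    using half_shift_J_orientation[OF v \<beta>B] .
  let ?B = "Gamma E Bs Cs \<sigma> (J_class E Cs v) B"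
  have eq: "?B = inv_into Bs (beta_bar E Bs Cs \<sigma>) (R_class E Cs O2)"
    using B jac_action_eq[OF v \<beta>B O2] by (simp add: Gamma_def beta_bar_def)
  have "R_class E Cs O2 \<in> beta_bar E Bs Cs \<sigma> ` Bs"
    using bij O2(1) by (simp add: bij_betw_def reversal_classes_def)
  then have B': "?B \<in> Bs" "beta_bar E Bs Cs \<sigma> ?B = R_class E Cs O2"
    unfolding eq by (rule inv_into_into, rule f_inv_into_f)
  then show "?B \<in> Bs" by simp
  have "J_equiv E Cs O2 (beta E Bs \<sigma> ?B)"
    using B'(2) R_class_eq_iff[OF O2(1) beta_J(1)[OF sig B'(1)]] unfolding beta_bar_def by simp
  then show "J_equiv E Cs (v + beta E Bs \<sigma> B) (beta E Bs \<sigma> ?B)" by (rule J_trans[OF O2(2)])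
qed

text \<open>A description of \<Gamma> free of inverse functions and choices; its invariance under
  reorientation is read off from it.\<close>

lemma Gamma_iff:
  assumes sig: "circuit_signature Cs \<sigma>" "acyclic_signature \<sigma>"
    and v: "v \<in> int_vecs E" and B: "B1 \<in> Bs" "B2 \<in> Bs"
  shows "Gamma E Bs Cs \<sigma> (J_class E Cs v) B1 = B2 \<longleftrightarrow>
    J_equiv E Cs (v + beta E Bs \<sigma> B1) (beta E Bs \<sigma> B2)"
proof
  assume "Gamma E Bs Cs \<sigma> (J_class E Cs v) B1 = B2"
  then show "J_equiv E Cs (v + beta E Bs \<sigma> B1) (beta E Bs \<sigma> B2)"
    using Gamma_act(2)[OF sig v B(1)] by simp
next
  assume "J_equiv E Cs (v + beta E Bs \<sigma> B1) (beta E Bs \<sigma> B2)"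
  from J_trans[OF J_sym[OF Gamma_act(2)[OF sig v B(1)]] this]
  show "Gamma E Bs Cs \<sigma> (J_class E Cs v) B1 = B2"
    by (rule beta_J(2)[OF sig Gamma_act(1)[OF sig v B(1)] B(2)])
qed

lemma Gamma_simply_transitive:
  assumes sig: "circuit_signature Cs \<sigma>" "acyclic_signature \<sigma>"
  shows "simply_transitive_action (Jac E Cs) Bs (Gamma E Bs Cs \<sigma>)"
proof (rule representative_action[of _ "beta E Bs \<sigma>"])
  show "Bs \<noteq> {}" by (rule bases_nonempty)
  show "Gamma E Bs Cs \<sigma> g \<in> extensional Bs" for g
    unfolding Gamma_def by (rule restrict_extensional)
  show "beta E Bs \<sigma> B \<in> half_vecs E" if "B \<in> Bs" for B
    by (rule orientation_half[OF beta_J(1)[OF sig that]])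
qed (rule beta_J(2)[OF sig] Gamma_act[OF sig]; assumption)+

end


section \<open>Reorientation\<close>

lemma reorient_reorient [simp]: "reorient Y (reorient Y v) = v"
  by (auto simp: reorient_def)

lemma reorient_inj: "inj_on (reorient Y) A"
  by (metis inj_onI reorient_reorient)

lemma reorient_add: "reorient Y (u + v) = reorient Y u + reorient Y v"
  and reorient_diff: "reorient Y (u - v) = reorient Y u - reorient Y v"
  and reorient_uminus: "reorient Y (- v) = - reorient Y v"
  and reorient_zero: "reorient Y 0 = 0"
  by (auto simp: reorient_def fun_eq_iff)

lemma supp_reorient [simp]: "supp (reorient Y v) = supp v"
  by (auto simp: supp_def reorient_def)

lemma reorient_int_vecs: "v \<in> int_vecs S \<Longrightarrow> reorient Y v \<in> int_vecs S"
  by (auto simp: int_vecs_def rat_vecs_def reorient_def)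

lemma proj_reorient: "proj (reorient (X <+> X) v) = reorient X (proj v)"
  by (simp add: proj_def reorient_def fun_eq_iff)

lemma pairing_reorient: "pairing E (reorient (X <+> X) u) (reorient (X <+> X) v) = pairing E u v"
  unfolding pairing_def by (intro sum.cong refl) (simp add: reorient_def)

lemma reorient_circuits_involution [simp]: "reorient_circuits X (reorient_circuits X Cs) = Cs"
  by (simp add: reorient_circuits_def image_image)

lemma reorient_mem_iff [simp]: "reorient (X <+> X) C \<in> reorient_circuits X Cs \<longleftrightarrow> C \<in> Cs"
  unfolding reorient_circuits_def using inj_image_mem_iff[OF reorient_inj] .

lemma representation_reorient:
  assumes "regular_representation E Bs Cs"
  shows "regular_representation E Bs (reorient_circuits X Cs)"
  unfolding regular_representation_def
proof (intro conjI ballI)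
  fix C assume "C \<in> reorient_circuits X Cs"
  then obtain D where D: "D \<in> Cs" "C = reorient (X <+> X) D" by (auto simp: reorient_circuits_def)
  show "C \<in> int_vecs (E <+> E)"
    using assms D by (simp add: regular_representation_def reorient_int_vecs)
  have "D i \<in> {0, 1, -1}" for i using assms D(1) by (simp add: regular_representation_def)
  then show "\<forall>i. C i \<in> {0, 1, -1}" unfolding D(2) reorient_def
    by (metis (no_types, lifting) insertE insertI1 insert_commute minus_minus minus_zero singletonD)
  fix C' assume "C' \<in> reorient_circuits X Cs"
  then obtain D' where "D' \<in> Cs" "C' = reorient (X <+> X) D'" by (auto simp: reorient_circuits_def)
  then show "pairing E C C' = 0"
    using assms D by (simp add: regular_representation_def pairing_reorient)
next
  have "uminus ` reorient_circuits X Cs = reorient (X <+> X) ` (uminus ` Cs)"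
    by (simp add: reorient_circuits_def image_image reorient_uminus)
  then show "uminus ` reorient_circuits X Cs = reorient_circuits X Cs"
    using assms by (simp add: regular_representation_def reorient_circuits_def)
  have "supp ` reorient_circuits X Cs = supp ` Cs"
    by (simp add: reorient_circuits_def image_image)
  then show "supp ` reorient_circuits X Cs = {K. circuit E Bs K}"
    using assms by (simp add: regular_representation_def)
qed

lemma circuit_signature_reorient:
  assumes "circuit_signature Cs \<sigma>"
  shows "circuit_signature (reorient_circuits X Cs) (reorient_circuits X \<sigma>)"
  unfolding circuit_signature_def
proof (intro conjI ballI)
  show "reorient_circuits X \<sigma> \<subseteq> reorient_circuits X Cs"
    using assms by (auto simp: circuit_signature_def reorient_circuits_def)
  fix C assume "C \<in> reorient_circuits X Cs"
  then obtain D where "D \<in> Cs" "C = reorient (X <+> X) D" by (auto simp: reorient_circuits_def)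
  then show "(C \<in> reorient_circuits X \<sigma>) \<noteq> (- C \<in> reorient_circuits X \<sigma>)"
    using assms by (simp add: circuit_signature_def reorient_uminus[symmetric])
qed

text \<open>Reorientation multiplies each coordinate of a linear relation by 1 or -1, so the same
  coefficients satisfy the original relation.\<close>

lemma acyclic_signature_reorient:
  assumes "acyclic_signature \<sigma>"
  shows "acyclic_signature (reorient_circuits X \<sigma>)"
  unfolding acyclic_signature_def
proof (intro allI impI)
  fix c :: "('a + 'a \<Rightarrow> rat) \<Rightarrow> real"
  let ?r = "reorient (X <+> X)"
  assume c: "(\<forall>C\<in>reorient_circuits X \<sigma>. 0 \<le> c C) \<and>
    (\<forall>i. (\<Sum>C\<in>reorient_circuits X \<sigma>. c C * of_rat (C i)) = 0)"
  have "(\<Sum>C\<in>\<sigma>. c (?r C) * of_rat (C i)) = 0" for i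
  proof -
    have "(\<Sum>C\<in>\<sigma>. c (?r C) * of_rat (?r C i)) = 0"
      using c unfolding reorient_circuits_def by (simp add: sum.reindex[OF reorient_inj])
    moreover have "?r C i = (if i \<in> X <+> X then -1 else 1) * C i" for C
      by (simp add: reorient_def)
    ultimately show ?thesis
      by (cases "i \<in> X <+> X") (simp_all add: of_rat_minus sum_negf)
  qed
  moreover have "\<forall>C\<in>\<sigma>. 0 \<le> c (?r C)" using c by (simp add: reorient_circuits_def)
  ultimately have "\<forall>C\<in>\<sigma>. c (?r C) = 0"
    using assms[unfolded acyclic_signature_def, rule_format, of "\<lambda>C. c (?r C)"] by simp
  then show "\<forall>C\<in>reorient_circuits X \<sigma>. c C = 0" by (simp add: reorient_circuits_def)
qed

context regular_orthogonal_representation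
begin

section \<open>Invariance of the Jacobian\<close>

lemma reorient_regular: "regular_orthogonal_representation E Bs (reorient_circuits X Cs)"
  by unfold_locales (rule representation_reorient[OF representation])

text \<open>Stated in one direction only: reorientation is an involution, so the reoriented
  representation gives the converse.\<close>

lemma lattice_reorient_mono:
  assumes "w \<in> circuit_lattice E Cs"
  shows "reorient X w \<in> circuit_lattice E (reorient_circuits X Cs)"
proof -
  interpret R: regular_orthogonal_representation E Bs "reorient_circuits X Cs"
    by (rule reorient_regular)
  have gen: "reorient X (proj C) \<in> circuit_lattice E (reorient_circuits X Cs)" if "C \<in> Cs" for C
    using R.lattice_proj[of "reorient (X <+> X) C"] that by (simp add: proj_reorient)
  show ?thesis
    using assms unfolding circuit_lattice_def[of E Cs]
  proof (induction rule: generate.induct)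
    case one
    have "\<one>\<^bsub>int_vec_group E\<^esub> = 0" by (simp add: int_vec_group_def)
    then show ?case using R.lattice_zero by (simp only: reorient_zero)
  next
    case (incl h)
    then show ?case using gen by auto
  next
    case (inv h)
    then obtain C where C: "C \<in> Cs" "h = proj C" by auto
    then have "h \<in> int_vecs E" using proj_circuit_int by blast
    then show ?case
      using R.lattice_uminus[OF gen[OF C(1)]] by (simp only: inv_int_vec_group reorient_uminus C(2))
  next
    case (eng h1 h2)
    then show ?case
      using R.lattice_add[OF eng.IH] unfolding reorient_add[symmetric]
      by (simp only: int_vec_group_def monoid.simps)
  qed
qed

lemma J_equiv_reorient:
  "J_equiv E (reorient_circuits X Cs) (reorient X v) (reorient X w) \<longleftrightarrow> J_equiv E Cs v w"
proof -
  interpret R: regular_orthogonal_representation E Bs "reorient_circuits X Cs"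
    by (rule reorient_regular)
  have "reorient X (w - v) \<in> circuit_lattice E (reorient_circuits X Cs) \<longleftrightarrow> w - v \<in> circuit_lattice E Cs"
    using lattice_reorient_mono[of "w - v" X] R.lattice_reorient_mono[of "reorient X (w - v)" X] by auto
  then show ?thesis by (simp only: J_equiv_def reorient_diff)
qed

lemma J_class_reorient:
  "J_class E (reorient_circuits X Cs) (reorient X v) = reorient X ` J_class E Cs v"
proof
  show "J_class E (reorient_circuits X Cs) (reorient X v) \<subseteq> reorient X ` J_class E Cs v"
  proof
    fix w assume "w \<in> J_class E (reorient_circuits X Cs) (reorient X v)"
    then have "reorient X w \<in> J_class E Cs v"
      using J_equiv_reorient[of X v "reorient X w"] by (simp add: J_class_def)
    then show "w \<in> reorient X ` J_class E Cs v" by (metis imageI reorient_reorient)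
  qed
qed (auto simp: J_class_def J_equiv_reorient)

text \<open>Elements of the Jacobian are sets of vectors, so the isomorphism is taken to be the
  image map.\<close>

lemma Jac_reorient_iso:
  "image (reorient X) \<in> iso (Jac E Cs) (Jac E (reorient_circuits X Cs))"
proof -
  interpret R: regular_orthogonal_representation E Bs "reorient_circuits X Cs"
    by (rule reorient_regular)
  have car: "carrier (Jac E (reorient_circuits X Cs)) = image (reorient X) ` carrier (Jac E Cs)"
  proof -
    have "int_vecs E = reorient X ` int_vecs E"
    proof
      show "int_vecs E \<subseteq> reorient X ` int_vecs E"
        using reorient_int_vecs by (metis imageI reorient_reorient subsetI)
    qed (use reorient_int_vecs in blast)
    then have "carrier (Jac E (reorient_circuits X Cs)) =
        J_class E (reorient_circuits X Cs) ` reorient X ` int_vecs E"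
      by (simp add: carrier_Jac)
    then show ?thesis by (simp add: carrier_Jac image_image J_class_reorient)
  qed
  have "inj_on (image (reorient X)) (carrier (Jac E Cs))"
    by (intro inj_onI) (simp only: inj_image_eq_iff[OF reorient_inj])
  moreover have "image (reorient X) \<in> hom (Jac E Cs) (Jac E (reorient_circuits X Cs))"
  proof (rule homI)
    fix g h assume "g \<in> carrier (Jac E Cs)" "h \<in> carrier (Jac E Cs)"
    then obtain v w where "v \<in> int_vecs E" "g = J_class E Cs v" "w \<in> int_vecs E" "h = J_class E Cs w"
      by (auto simp: carrier_Jac)
    then show "reorient X ` (g \<otimes>\<^bsub>Jac E Cs\<^esub> h) =
        reorient X ` g \<otimes>\<^bsub>Jac E (reorient_circuits X Cs)\<^esub> reorient X ` h"
      by (simp add: Jac_mult R.Jac_mult reorient_int_vecs J_class_reorient[symmetric] reorient_add)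
  qed (simp add: car)
  ultimately show ?thesis by (simp add: iso_def bij_betw_def car)
qed

section \<open>Invariance of \<beta> and \<Gamma>\<close>

lemma beta_reorient:
  assumes sig: "circuit_signature Cs \<sigma>" and B: "B \<in> Bs"
  shows "beta E Bs (reorient_circuits X \<sigma>) B = reorient X (beta E Bs \<sigma> B)"
proof
  fix e
  interpret R: regular_orthogonal_representation E Bs "reorient_circuits X Cs"
    by (rule reorient_regular)
  let ?r = "reorient (X <+> X)"
  obtain F where F: "fundamental B F" using fundamental_exists[OF B] .
  \<comment> \<open>Reorientation negates the entry of \<open>F x\<close> at \<open>x\<close> when
    \<open>x\<close> lies over \<open>X\<close>; the extra sign restores the normalisation.
    Membership in the signature is therefore inverted exactly over \<open>X\<close>.\<close>
  define F' where "F' x = (if x \<in> X <+> X then - ?r (F x) else ?r (F x))" for x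
  have sig': "circuit_signature (reorient_circuits X Cs) (reorient_circuits X \<sigma>)"
    by (rule circuit_signature_reorient[OF sig])
  have F': "R.fundamental B F'"
    unfolding R.fundamental_def
  proof (intro ballI conjI)
    fix x assume x: "x \<in> (E <+> E) - B"
    show "F' x \<in> reorient_circuits X Cs"
      using fundamental_in_Cs[OF F x] R.uminus_circuit[of "?r (F x)"] by (simp add: F'_def)
    show "supp (F' x) \<subseteq> sym_diff B {x, star x}"
      using fundamental_supp[OF F x] by (simp add: F'_def)
    fix y assume "y \<in> (E <+> E) - B"
    then show "F' x y = of_bool (y = x)"
      using fundamental_delta[OF F x, of y] by (auto simp: F'_def reorient_def)
  qed
  show "beta E Bs (reorient_circuits X \<sigma>) B e = reorient X (beta E Bs \<sigma> B) e"
  proof (cases "e \<in> E")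
    case True
    obtain x where x: "x \<in> {Inl e, Inr e} - B"
      using basis_iff[OF B, of "Inl e"] True by auto
    then have xN: "x \<in> (E <+> E) - B" using True by auto
    have "x \<in> X <+> X \<longleftrightarrow> e \<in> X" using x by auto
    moreover have "F' x \<in> reorient_circuits X \<sigma> \<longleftrightarrow> (if x \<in> X <+> X then F x \<notin> \<sigma> else F x \<in> \<sigma>)"
      using R.signature_cases[OF sig', of "?r (F x)"] fundamental_in_Cs[OF F xN] by (simp add: F'_def)
    ultimately show ?thesis
      using beta_eq[OF sig B F True x] R.beta_eq[OF sig' B F' True x] by (simp add: reorient_def)
  qed (simp add: beta_def reorient_def)
qed

lemma Gamma_reorient:
  assumes sig: "circuit_signature Cs \<sigma>" "acyclic_signature \<sigma>"
    and v: "v \<in> int_vecs E" and B: "B1 \<in> Bs" "B2 \<in> Bs"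
  shows "Gamma E Bs Cs \<sigma> (J_class E Cs v) B1 = B2 \<longleftrightarrow>
    Gamma E Bs (reorient_circuits X Cs) (reorient_circuits X \<sigma>)
      (J_class E (reorient_circuits X Cs) (reorient X v)) B1 = B2"
proof -
  interpret R: regular_orthogonal_representation E Bs "reorient_circuits X Cs"
    by (rule reorient_regular)
  show ?thesis
    unfolding Gamma_iff[OF sig v B] R.Gamma_iff[OF circuit_signature_reorient[OF sig(1)]
        acyclic_signature_reorient[OF sig(2)] reorient_int_vecs[OF v] B]
      beta_reorient[OF sig(1) B(1)] beta_reorient[OF sig(1) B(2)] reorient_add[symmetric]
    by (rule J_equiv_reorient[symmetric])
qed

end

theorem theorem2:
  fixes E :: "'a set"
    and Bs :: "('a + 'a) set set"
    and Cs :: "('a + 'a \<Rightarrow> rat) set"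
  assumes regular: "regular_orthogonal_matroid E Bs"
    and representation: "regular_representation E Bs Cs"
  shows
    \<comment> \<open>(1) existence of \<open>O\<^sub>2\<close>, independence of all choices, simple transitivity\<close>
    "((\<forall>v \<in> int_vecs E. \<forall>O1 \<in> orientations E. \<exists>O2 \<in> orientations E. J_equiv E Cs (v + O1) O2) \<and>
      (\<forall>v \<in> int_vecs E. \<forall>v' \<in> int_vecs E.
         \<forall>O1 \<in> orientations E. \<forall>O1' \<in> orientations E.
         \<forall>O2 \<in> orientations E. \<forall>O2' \<in> orientations E.
           J_class E Cs v = J_class E Cs v' \<and> R_class E Cs O1 = R_class E Cs O1' \<and>
           J_equiv E Cs (v + O1) O2 \<and> J_equiv E Cs (v' + O1') O2' \<longrightarrow>
           R_class E Cs O2 = R_class E Cs O2') \<and>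
      (\<forall>v \<in> int_vecs E. \<forall>O1 \<in> orientations E. \<forall>O2 \<in> orientations E.
         J_equiv E Cs (v + O1) O2 \<longrightarrow>
         jac_action E Cs (J_class E Cs v) (R_class E Cs O1) = R_class E Cs O2) \<and>
      simply_transitive_action (Jac E Cs) (reversal_classes E Cs) (jac_action E Cs)) \<and>
     (\<forall>\<sigma>. circuit_signature Cs \<sigma> \<and> acyclic_signature \<sigma> \<longrightarrow>
        bij_betw (beta_bar E Bs Cs \<sigma>) Bs (reversal_classes E Cs) \<and>
        simply_transitive_action (Jac E Cs) Bs (Gamma E Bs Cs \<sigma>)) \<and>
     (\<forall>X. X \<subseteq> E \<longrightarrow>
        (\<exists>\<phi> \<in> iso (Jac E Cs) (Jac E (reorient_circuits X Cs)).
           \<forall>v \<in> int_vecs E.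
             \<phi> (J_class E Cs v) = J_class E (reorient_circuits X Cs) (reorient X v)) \<and>
        (\<forall>\<sigma>. circuit_signature Cs \<sigma> \<and> acyclic_signature \<sigma> \<longrightarrow>
           circuit_signature (reorient_circuits X Cs) (reorient_circuits X \<sigma>) \<and>
           acyclic_signature (reorient_circuits X \<sigma>) \<and>
           (\<forall>v \<in> int_vecs E. \<forall>B1 \<in> Bs. \<forall>B2 \<in> Bs.
              Gamma E Bs Cs \<sigma> (J_class E Cs v) B1 = B2 \<longleftrightarrow>
              Gamma E Bs (reorient_circuits X Cs) (reorient_circuits X \<sigma>)
                (J_class E (reorient_circuits X Cs) (reorient X v)) B1 = B2)))"
proof -
  interpret orthogonal_matroid E Bs
    using regular by (simp add: regular_orthogonal_matroid_def)
  interpret regular_orthogonal_representation E Bs Cs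
    by unfold_locales (rule representation)
  show ?thesis
  proof (intro conjI ballI allI impI, goal_cases)
    case (1 v O1)
    then show ?case using half_shift_J_orientation by blast
  next
    case (2 v v' O1 O1' O2 O2')
    then show ?case using jac_action_well_defined[of O1 O1' O2 O2' v v'] by blast
  next
    case (3 v O1 O2)
    then show ?case by (rule jac_action_eq)
  next
    case 4
    show ?case by (rule jac_action_simply_transitive)
  next
    case (5 \<sigma>)
    then show ?case by (blast intro: beta_bar_bij)
  next
    case (6 \<sigma>)
    then show ?case by (blast intro: Gamma_simply_transitive)
  next
    case (7 X)
    show ?case by (rule bexI[OF _ Jac_reorient_iso]) (simp add: J_class_reorient)
  next
    case (8 X \<sigma>)
    then show ?case by (blast intro: circuit_signature_reorient)
  next
    case (9 X \<sigma>)
    then show ?case by (blast intro: acyclic_signature_reorient)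
  next
    case (10 X \<sigma> v B1 B2)
    then show ?case by (intro Gamma_reorient) simp_all
  qed
qed

end
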